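(* Let $(A,\Delta)$ be an algebraic quantum group with left integral $\varphi$, right integral $\psi=\varphi\circ S$ and modular element $\delta\in M(A)$. Let $B=\widehat A$ be the dual, and let $\widehat\sigma$ and $\widehat\sigma'$ be the modular automorphisms of the left integral $\widehat\varphi$ and the right integral $\widehat\psi$ on $B$, respectively. For all $a\in A$ and $b\in B$ we have $$\langle a,\widehat\sigma(b)\rangle=\langle S^2(a)\delta^{-1},b\rangle,\qquad\langle a,\widehat\sigma'(b)\rangle=\langle\delta^{-1}S^{-2}(a),b\rangle.$$
   Context: All algebras are associative algebras over $\mathbb C$, possibly non-unital, with non-degenerate product; $M(A)$ is the multiplier algebra of $A$; $\iota$ denotes identity maps. Regular multiplier Hopf algebra: an algebra $A$ with a homomorphism $\Delta:A\to M(A\otimes A)$ such that $\Delta(a)(1\otimes a')$, $(a\otimes 1)\Delta(a')$, $\Delta(a)(a'\otimes 1)$ and $(1\otimes a)\Delta(a')$ lie in $A\otimes A$ for all $a,a'$; $\Delta$ is coassociative, $(a\otimes1\otimes1)(\Delta\otimes\iota)(\Delta(c)(1\otimes a'))=((\iota\otimes\Delta)((a\otimes1)\Delta(c)))(1\otimes1\otimes a')$; and the maps $a\otimes a'\mapsto\Delta(a)(1\otimes a')$, $a\otimes a'\mapsto(a\otimes1)\Delta(a')$, and the same two maps for the flipped coproduct, are bijections of $A\otimes A$. It has a unique counit $\varepsilon:A\to\mathbb C$ (a homomorphism) and antipode $S:A\to A$ (a bijective anti-homomorphism). A left (right) integral is a non-zero linear functional $\varphi$ (resp. $\psi$) on $A$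 with $(\iota\otimes\varphi)\Delta(a)=\varphi(a)1$ (resp. $(\psi\otimes\iota)\Delta(a)=\psi(a)1$) in $M(A)$ for all $a$; integrals are faithful and unique up to a scalar. An algebraic quantum group is a regular multiplier Hopf algebra with integrals. The modular element $\delta$ is the unique invertible element of $M(A)$ with $\varphi(S(a))=\varphi(a\delta)$ for all $a\in A$. Dual: $B=\widehat A=\{\varphi(\,\cdot\,c):c\in A\}$, with $\langle a,b\rangle=b(a)$. Its product is $\langle a,bb'\rangle=\langle\Delta(a),b\otimes b'\rangle$; its coproduct $\Delta:B\to M(B\otimes B)$ is determined by $\langle a\otimes a',(b'\otimes1)\Delta(b)\rangle=\langle\Delta(a)(1\otimes a'),b'\otimes b\rangle$ and $\langle a\otimes a',\Delta(b)(1\otimes b')\rangle=\langle(a\otimes1)\Delta(a'),b\otimes b'\rangle$. $(B,\Delta)$ is again an algebraic quantum group. Its right integral $\widehat\psi$ is $\widehat\psi(\varphi(\,\cdot\,a))=\varepsilon(a)$ and its left integral $\widehat\varphi$ is $\widehat\varphi(\psi(S(\,\cdot\,)a))=\varepsilon(a)$; one has $\widehat\psi=\widehat\varphi\circ S$. The modular automorphisms are the unique automorphisms of $B$ with $\widehat\varphi(bb')=\widehat\varphi(b'\widehat\sigma(b))$ and $\widehat\psi(bb')=\widehat\psi(b'\widehat\sigma'(b))$ for all $b,b'\in B$. *)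

theory Defs
  imports Complex_Main "HOL-Library.Poly_Mapping"
begin

section \<open>Complex vector spaces and algebras\<close>

class complex_vector = ab_group_add +
  fixes scaleC :: "complex \<Rightarrow> 'a \<Rightarrow> 'a" (infixr \<open>*\<^sub>C\<close> 75)
  assumes scaleC_right_distrib: "c *\<^sub>C (x + y) = c *\<^sub>C x + c *\<^sub>C y"
    and scaleC_left_distrib: "(c + d) *\<^sub>C x = c *\<^sub>C x + d *\<^sub>C x"
    and scaleC_scaleC: "c *\<^sub>C (d *\<^sub>C x) = (c * d) *\<^sub>C x"
    and scaleC_one: "1 *\<^sub>C x = x"

global_interpretation cvec: vector_space "scaleC :: complex \<Rightarrow> 'a \<Rightarrow> 'a::complex_vector"
  by unfold_locales (simp_all add: scaleC_right_distrib scaleC_left_distrib scaleC_scaleC scaleC_one)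

abbreviation clinear :: "('a::complex_vector \<Rightarrow> 'b::complex_vector) \<Rightarrow> bool"
  where "clinear \<equiv> Vector_Spaces.linear scaleC scaleC"

text \<open>Algebras are associative but need not have a unit.\<close>

class complex_algebra = complex_vector + ring +
  assumes scaleC_mult_left: "(c *\<^sub>C x) * y = c *\<^sub>C (x * y)"
    and scaleC_mult_right: "x * (c *\<^sub>C y) = c *\<^sub>C (x * y)"

class nondegenerate_algebra = complex_algebra +
  assumes nondegenerate_left: "(\<And>y. x * y = 0) \<Longrightarrow> x = 0"
    and nondegenerate_right: "(\<And>y. y * x = 0) \<Longrightarrow> x = 0"

instantiation complex :: complex_algebra
begin
definition scaleC_complex :: "complex \<Rightarrow> complex \<Rightarrow> complex" where "scaleC_complex = (*)"
instance by standard (simp_all add: scaleC_complex_def algebra_simps)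
end

lemma clinear_iff:
  "clinear f \<longleftrightarrow> (\<forall>x y. f (x + y) = f x + f y) \<and> (\<forall>c x. f (c *\<^sub>C x) = c *\<^sub>C f x)"
  by (auto simp: Vector_Spaces.linear_iff cvec.vector_space_axioms)

lemma clinearI:
  "(\<And>x y. f (x + y) = f x + f y) \<Longrightarrow> (\<And>c x. f (c *\<^sub>C x) = c *\<^sub>C f x) \<Longrightarrow> clinear f"
  by (simp add: clinear_iff)

lemma clinear_add: "clinear f \<Longrightarrow> f (x + y) = f x + f y"
  and clinear_scale: "clinear f \<Longrightarrow> f (c *\<^sub>C x) = c *\<^sub>C f x"
  by (auto simp: clinear_iff)

lemma clinear_0: "clinear f \<Longrightarrow> f 0 = 0"
  using clinear_add[of f 0 0] by simp

lemma clinear_sum: assumes "clinear f" shows "f (sum g S) = (\<Sum>i\<in>S. f (g i))"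
  by (induction S rule: infinite_finite_induct)
    (simp_all add: clinear_0[OF assms] clinear_add[OF assms])

lemma clinear_id [simp]: "clinear (\<lambda>x. x)"
  and clinear_mult_left: "clinear (\<lambda>x::'a::complex_algebra. a * x)"
  and clinear_mult_right: "clinear (\<lambda>x::'a::complex_algebra. x * a)"
  by (auto simp: clinear_iff algebra_simps scaleC_mult_left scaleC_mult_right)

definition bilinear_map :: "('a::complex_vector \<Rightarrow> 'b::complex_vector \<Rightarrow> 'c::complex_vector) \<Rightarrow> bool"
  where "bilinear_map f \<longleftrightarrow> (\<forall>b. clinear (\<lambda>a. f a b)) \<and> (\<forall>a. clinear (\<lambda>b. f a b))"

lemma bilinear_map_0:
  assumes "bilinear_map f" shows "f 0 b = 0" "f a 0 = 0"
proof -
  have "clinear (\<lambda>a. f a b)" "clinear (f a)" using assms by (simp_all add: bilinear_map_def)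
  then show "f 0 b = 0" "f a 0 = 0" using clinear_0[of "\<lambda>a. f a b"] clinear_0[of "f a"] by simp_all
qed

section \<open>Algebraic tensor products\<close>

text \<open>The tensor product is the free vector space on pairs, that is, the space of finitely
  supported functions, modulo the span of the bilinearity relations.\<close>

instantiation poly_mapping :: (type, complex_vector) complex_vector
begin
definition scaleC_poly_mapping :: "complex \<Rightarrow> ('a \<Rightarrow>\<^sub>0 'b) \<Rightarrow> ('a \<Rightarrow>\<^sub>0 'b)"
  where "scaleC_poly_mapping c = Poly_Mapping.map (scaleC c)"
instance
proof
  have l: "Poly_Mapping.lookup (c *\<^sub>C p) k = c *\<^sub>C Poly_Mapping.lookup p k"
    for c and p :: "'a \<Rightarrow>\<^sub>0 'b" and k
    by (simp add: scaleC_poly_mapping_def Poly_Mapping.map.rep_eq when_def)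
  fix c d and p q :: "'a \<Rightarrow>\<^sub>0 'b"
  show "c *\<^sub>C (p + q) = c *\<^sub>C p + c *\<^sub>C q" "(c + d) *\<^sub>C p = c *\<^sub>C p + d *\<^sub>C p"
    "c *\<^sub>C (d *\<^sub>C p) = (c * d) *\<^sub>C p" "1 *\<^sub>C p = p"
    by (rule poly_mapping_eqI, simp add: l lookup_add scaleC_right_distrib scaleC_left_distrib)+
qed
end

lemma lookup_scaleC: "Poly_Mapping.lookup (c *\<^sub>C p) k = c *\<^sub>C Poly_Mapping.lookup p k"
  by (simp add: scaleC_poly_mapping_def Poly_Mapping.map.rep_eq when_def)

abbreviation free_pair :: "'a \<Rightarrow> 'b \<Rightarrow> ('a \<times> 'b \<Rightarrow>\<^sub>0 complex)"
  where "free_pair a b \<equiv> Poly_Mapping.single (a, b) 1"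

definition tensor_relations :: "('a::complex_vector \<times> 'b::complex_vector \<Rightarrow>\<^sub>0 complex) set"
  where "tensor_relations =
     {free_pair (a + a') b - (free_pair a b + free_pair a' b) | a a' b. True}
   \<union> {free_pair a (b + b') - (free_pair a b + free_pair a b') | a b b'. True}
   \<union> {free_pair (c *\<^sub>C a) b - c *\<^sub>C free_pair a b | c a b. True}
   \<union> {free_pair a (c *\<^sub>C b) - c *\<^sub>C free_pair a b | c a b. True}"

quotient_type (overloaded) ('a, 'b) tensor =
    "'a::complex_vector \<times> 'b::complex_vector \<Rightarrow>\<^sub>0 complex"
  / "\<lambda>p q. p - q \<in> cvec.span tensor_relations"
  morphisms rep_tensor abs_tensor
proof (rule equivpI)
  show "reflp (\<lambda>p q. p - q \<in> cvec.span tensor_relations)"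
    by (rule reflpI) (simp add: cvec.span_zero)
  show "symp (\<lambda>p q. p - q \<in> cvec.span tensor_relations)"
    by (rule sympI, drule cvec.span_neg) simp
  show "transp (\<lambda>p q. p - q \<in> cvec.span tensor_relations)"
    by (rule transpI, drule (1) cvec.span_add) simp
qed

instantiation tensor :: (complex_vector, complex_vector) complex_vector
begin
lift_definition zero_tensor :: "('a, 'b) tensor" is 0 .
lift_definition plus_tensor :: "('a, 'b) tensor \<Rightarrow> ('a, 'b) tensor \<Rightarrow> ('a, 'b) tensor" is "(+)"
  by (simp add: add_diff_add cvec.span_add)
lift_definition uminus_tensor :: "('a, 'b) tensor \<Rightarrow> ('a, 'b) tensor" is uminus
  by (drule cvec.span_neg) simp
lift_definition minus_tensor :: "('a, 'b) tensor \<Rightarrow> ('a, 'b) tensor \<Rightarrow> ('a, 'b) tensor" is "(-)"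
  by (drule (1) cvec.span_diff) (simp add: algebra_simps)
lift_definition scaleC_tensor :: "complex \<Rightarrow> ('a, 'b) tensor \<Rightarrow> ('a, 'b) tensor" is scaleC
  by (simp add: cvec.scale_right_diff_distrib[symmetric] cvec.span_scale)
instance
  by standard (transfer, simp add: algebra_simps cvec.span_zero scaleC_right_distrib
      scaleC_left_distrib scaleC_scaleC scaleC_one)+
end

lift_definition tensor_pair :: "'a::complex_vector \<Rightarrow> 'b::complex_vector \<Rightarrow> ('a, 'b) tensor"
    (infixr \<open>\<otimes>\<close> 80) is free_pair .

lemma bilinear_tensor_pair: "bilinear_map (\<otimes>)"
  unfolding bilinear_map_def
proof (intro conjI allI clinearI)
  fix a a' :: 'a and b b' :: 'b and c
  show "(a + a') \<otimes> b = a \<otimes> b + a' \<otimes> b"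
    by transfer (rule cvec.span_base, unfold tensor_relations_def, blast)
  show "a \<otimes> (b + b') = a \<otimes> b + a \<otimes> b'"
    by transfer (rule cvec.span_base, unfold tensor_relations_def, blast)
  show "(c *\<^sub>C a) \<otimes> b = c *\<^sub>C (a \<otimes> b)" "a \<otimes> (c *\<^sub>C b) = c *\<^sub>C (a \<otimes> b)"
    by (transfer, rule cvec.span_base, unfold tensor_relations_def, blast)+
qed

lemma tensor_pair_linear:
  "(a + a') \<otimes> b = a \<otimes> b + a' \<otimes> b" "a \<otimes> (b + b') = a \<otimes> b + a \<otimes> b'"
  "(c *\<^sub>C a) \<otimes> b = c *\<^sub>C (a \<otimes> b)" "a \<otimes> (c *\<^sub>C b) = c *\<^sub>C (a \<otimes> b)"
  using bilinear_tensor_pair unfolding bilinear_map_def clinear_iff by blast+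

text \<open>\<open>tensor_lift f\<close> is the linear map induced by \<open>f\<close>; it is meaningful when \<open>f\<close> is bilinear,
  and then does not depend on the chosen representative.\<close>

definition free_lift :: "('a \<Rightarrow> 'b \<Rightarrow> 'c::complex_vector) \<Rightarrow> ('a \<times> 'b \<Rightarrow>\<^sub>0 complex) \<Rightarrow> 'c"
  where "free_lift f p =
    (\<Sum>k\<in>Poly_Mapping.keys p. Poly_Mapping.lookup p k *\<^sub>C f (fst k) (snd k))"

definition tensor_lift ::
    "('a::complex_vector \<Rightarrow> 'b::complex_vector \<Rightarrow> 'c::complex_vector) \<Rightarrow> ('a, 'b) tensor \<Rightarrow> 'c"
  where "tensor_lift f x = free_lift f (rep_tensor x)"

lemma free_lift_superset:
  assumes "finite K" "Poly_Mapping.keys p \<subseteq> K"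
  shows "free_lift f p = (\<Sum>k\<in>K. Poly_Mapping.lookup p k *\<^sub>C f (fst k) (snd k))"
  unfolding free_lift_def using assms
  by (intro sum.mono_neutral_left) (auto simp: in_keys_iff)

lemma clinear_free_lift: "clinear (free_lift f)"
proof (rule clinearI)
  fix p q :: "'a \<times> 'b \<Rightarrow>\<^sub>0 complex" and c
  let ?K = "Poly_Mapping.keys p \<union> Poly_Mapping.keys q"
  have "Poly_Mapping.keys (p + q) \<subseteq> ?K" by (rule Poly_Mapping.keys_add)
  then show "free_lift f (p + q) = free_lift f p + free_lift f q"
    by (simp add: free_lift_superset[of ?K] lookup_add scaleC_left_distrib sum.distrib)
  have "Poly_Mapping.keys (c *\<^sub>C p) \<subseteq> Poly_Mapping.keys p"
    by (auto simp: in_keys_iff lookup_scaleC)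
  then show "free_lift f (c *\<^sub>C p) = c *\<^sub>C free_lift f p"
    by (simp add: free_lift_superset[of "Poly_Mapping.keys p"] lookup_scaleC
        cvec.scale_sum_right scaleC_complex_def scaleC_scaleC)
qed

lemma free_lift_pair: "free_lift f (free_pair a b) = f a b"
  by (simp add: free_lift_def scaleC_one)

lemma free_lift_relations:
  assumes f: "bilinear_map f" and "p \<in> cvec.span tensor_relations"
  shows "free_lift f p = 0"
proof -
  interpret L: Vector_Spaces.linear scaleC scaleC "free_lift f" by (rule clinear_free_lift)
  from assms(2) show ?thesis
  proof (induction rule: cvec.span_induct_alt)
    case (step c x y)
    have "free_lift f x = 0"
      using step(1) f
      by (auto simp: tensor_relations_def L.diff L.add L.scale free_lift_pair bilinear_map_def clinear_iff)
    then show ?case using step by (simp add: L.add L.scale)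
  qed (simp add: L.zero)
qed

lemma tensor_lift_abs:
  assumes "bilinear_map f" shows "tensor_lift f (abs_tensor p) = free_lift f p"
proof -
  interpret L: Vector_Spaces.linear scaleC scaleC "free_lift f" by (rule clinear_free_lift)
  have "rep_tensor (abs_tensor p) - p \<in> cvec.span tensor_relations"
    by (rule Quotient_rep_abs[OF Quotient_tensor]) (simp add: cvec.span_zero)
  then show ?thesis
    using free_lift_relations[OF assms, of "rep_tensor (abs_tensor p) - p"]
    by (simp add: tensor_lift_def L.diff)
qed

lemma clinear_tensor_lift: assumes "bilinear_map f" shows "clinear (tensor_lift f)"
proof (rule clinearI)
  fix x y :: "('a, 'b) tensor" and c
  obtain p where "x = abs_tensor p" by (induction x rule: tensor.abs_induct) simp
  moreover obtain q where "y = abs_tensor q" by (induction y rule: tensor.abs_induct) simp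
  ultimately show "tensor_lift f (x + y) = tensor_lift f x + tensor_lift f y"
    and "tensor_lift f (c *\<^sub>C x) = c *\<^sub>C tensor_lift f x"
    by (simp_all add: plus_tensor.abs_eq scaleC_tensor.abs_eq tensor_lift_abs[OF assms]
        clinear_add[OF clinear_free_lift] clinear_scale[OF clinear_free_lift])
qed

lemma tensor_lift_pair [simp]: "bilinear_map f \<Longrightarrow> tensor_lift f (a \<otimes> b) = f a b"
  by (simp add: tensor_pair.abs_eq tensor_lift_abs free_lift_pair)

lemma tensor_induct [case_names pair add]:
  assumes "\<And>a b. P (a \<otimes> b)" and "\<And>x y. P x \<Longrightarrow> P y \<Longrightarrow> P (x + y)"
  shows "P x"
proof (induction x rule: tensor.abs_induct)
  case (1 p)
  note sc = tensor_pair_linear(3)[symmetric]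
  have gen: "P (\<Sum>k\<in>K. g k *\<^sub>C (fst k \<otimes> snd k))" if "finite K" for K g
    using that
  proof (induction K)
    case empty
    have "P (0 \<otimes> 0)" by (rule assms)
    then show ?case by (simp add: bilinear_map_0[OF bilinear_tensor_pair])
  qed (simp add: assms sc)
  have "abs_tensor p = free_lift (\<otimes>) p"
  proof -
    have "p = (\<Sum>k\<in>Poly_Mapping.keys p. Poly_Mapping.lookup p k *\<^sub>C free_pair (fst k) (snd k))"
      by (rule poly_mapping_eqI)
        (auto simp: lookup_sum lookup_scaleC scaleC_complex_def lookup_single when_def
          sum.delta in_keys_iff if_distrib cong: if_cong)
    moreover have "clinear abs_tensor"
      by (rule clinearI) (simp_all add: plus_tensor.abs_eq scaleC_tensor.abs_eq)
    ultimately have "abs_tensor p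
        = (\<Sum>k\<in>Poly_Mapping.keys p. Poly_Mapping.lookup p k *\<^sub>C abs_tensor (free_pair (fst k) (snd k)))"
      using clinear_sum[of abs_tensor] clinear_scale[of abs_tensor] by (metis (no_types, lifting) sum.cong)
    then show ?thesis by (simp add: free_lift_def tensor_pair.abs_eq)
  qed
  then show ?case unfolding free_lift_def using gen by simp
qed

lemma tensor_lift_unique:
  assumes "clinear g" "clinear h" "\<And>a b. g (a \<otimes> b) = h (a \<otimes> b)"
  shows "g x = h x"
  by (induction x rule: tensor_induct)
    (simp_all add: assms(3) clinear_add[OF assms(1)] clinear_add[OF assms(2)])

lifting_forget tensor.lifting

lemma bilinear_map_comp:
  "bilinear_map h \<Longrightarrow> clinear f \<Longrightarrow> clinear g \<Longrightarrow> bilinear_map (\<lambda>a b. h (f a) (g b))"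
  by (auto simp: bilinear_map_def clinear_iff)

lemma clinear_bilinear_comp: "clinear g \<Longrightarrow> bilinear_map f \<Longrightarrow> bilinear_map (\<lambda>a b. g (f a b))"
  by (auto simp: bilinear_map_def clinear_iff)

lemma bilinear_mult: "bilinear_map ((*) :: 'a::complex_algebra \<Rightarrow> _)"
  by (auto simp: bilinear_map_def clinear_mult_left clinear_mult_right)

lemma bilinear_tensor_lift:
  assumes "\<And>a b. bilinear_map (f a b)" "\<And>c d. bilinear_map (\<lambda>a b. f a b c d)"
  shows "bilinear_map (\<lambda>a b. tensor_lift (f a b) y)"
proof (induction y rule: tensor_induct)
  case (pair c d)
  then show ?case using assms by simp
next
  case (add x y)
  have "tensor_lift (f a b) (x + y) = tensor_lift (f a b) x + tensor_lift (f a b) y" for a b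
    by (rule clinear_add[OF clinear_tensor_lift[OF assms(1)]])
  with add show ?case by (auto simp: bilinear_map_def clinear_iff algebra_simps scaleC_right_distrib)
qed

definition tensor_map where "tensor_map f g = tensor_lift (\<lambda>a b. f a \<otimes> g b)"

definition tensor_flip :: "('a::complex_vector, 'b::complex_vector) tensor \<Rightarrow> ('b, 'a) tensor"
  where "tensor_flip = tensor_lift (\<lambda>a b. b \<otimes> a)"

definition tensor_assoc ::
    "(('a::complex_vector, 'b::complex_vector) tensor, 'c::complex_vector) tensor
      \<Rightarrow> ('a, ('b, 'c) tensor) tensor"
  where "tensor_assoc = tensor_lift (\<lambda>x c. tensor_lift (\<lambda>a b. a \<otimes> b \<otimes> c) x)"

lemma bilinear_tensor_map:
  "clinear f \<Longrightarrow> clinear g \<Longrightarrow> bilinear_map (\<lambda>a b. f a \<otimes> g b)"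
  by (rule bilinear_map_comp[OF bilinear_tensor_pair])

lemma bilinear_flip: "bilinear_map (\<lambda>a b. b \<otimes> a)"
  using bilinear_tensor_pair by (auto simp: bilinear_map_def)

lemma clinear_tensor_map: "clinear f \<Longrightarrow> clinear g \<Longrightarrow> clinear (tensor_map f g)"
  unfolding tensor_map_def by (intro clinear_tensor_lift bilinear_tensor_map)

lemma tensor_map_pair [simp]:
  "clinear f \<Longrightarrow> clinear g \<Longrightarrow> tensor_map f g (a \<otimes> b) = f a \<otimes> g b"
  by (simp add: tensor_map_def bilinear_tensor_map)

lemma clinear_tensor_flip: "clinear tensor_flip"
  unfolding tensor_flip_def by (intro clinear_tensor_lift bilinear_flip)

lemma tensor_flip_pair [simp]: "tensor_flip (a \<otimes> b) = b \<otimes> a"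
  by (simp add: tensor_flip_def bilinear_flip)

lemma tensor_flip_flip [simp]: "tensor_flip (tensor_flip x) = x"
  by (induction x rule: tensor_induct) (simp_all add: clinear_add[OF clinear_tensor_flip])

instantiation tensor :: (complex_algebra, complex_algebra) complex_algebra
begin

definition times_tensor :: "('a, 'b) tensor \<Rightarrow> ('a, 'b) tensor \<Rightarrow> ('a, 'b) tensor"
  where "times_tensor x y = tensor_lift (\<lambda>a b. tensor_lift (\<lambda>c d. (a * c) \<otimes> (b * d)) y) x"

lemma times_tensor_bilinear:
  "bilinear_map (\<lambda>c d. (a * c) \<otimes> (b * d))"
  "bilinear_map (\<lambda>a b. (a * e) \<otimes> (b * f))"
  "bilinear_map (\<lambda>a b. tensor_lift (\<lambda>c d. (a * c) \<otimes> (b * d)) y)"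
  for y :: "('a, 'b) tensor" and a e :: 'a and b f :: 'b
  by (intro bilinear_tensor_lift bilinear_tensor_map clinear_mult_left clinear_mult_right)+

lemma times_tensor_pair: "(a \<otimes> b) * (c \<otimes> d) = (a * c) \<otimes> (b * d)" for a c :: 'a and b d :: 'b
  by (simp add: times_tensor_def times_tensor_bilinear)

lemma times_tensor_linear_left: "clinear (\<lambda>x. x * y)" for y :: "('a, 'b) tensor"
  unfolding times_tensor_def by (intro clinear_tensor_lift times_tensor_bilinear)

lemma times_tensor_linear_right: "clinear (\<lambda>y. x * y)" for x :: "('a, 'b) tensor"
proof (induction x rule: tensor_induct)
  case (pair a b)
  show ?case by (simp add: times_tensor_def times_tensor_bilinear clinear_tensor_lift)
next
  case (add x y)
  then show ?case
    by (auto simp: clinear_iff scaleC_right_distrib algebra_simps clinear_add[OF times_tensor_linear_left])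
qed

instance
proof
  fix x y z :: "('a, 'b) tensor" and c
  note l = clinear_add[OF times_tensor_linear_left] clinear_add[OF times_tensor_linear_right]
  show "(x + y) * z = x * z + y * z" "x * (y + z) = x * y + x * z" by (rule l)+
  show "c *\<^sub>C x * y = c *\<^sub>C (x * y)" by (rule clinear_scale[OF times_tensor_linear_left])
  show "x * (c *\<^sub>C y) = c *\<^sub>C (x * y)" by (rule clinear_scale[OF times_tensor_linear_right])
  have "(a \<otimes> b) * (c \<otimes> d) * z = (a \<otimes> b) * ((c \<otimes> d) * z)" for a c :: 'a and b d :: 'b
    by (induction z rule: tensor_induct) (simp_all add: times_tensor_pair mult.assoc l)
  then have "(a \<otimes> b) * y * z = (a \<otimes> b) * (y * z)" for a :: 'a and b :: 'b
    by (induction y rule: tensor_induct) (simp_all add: l)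
  then show "x * y * z = x * (y * z)"
    by (induction x rule: tensor_induct) (simp_all add: l)
qed

end

text \<open>Slice maps \<open>\<iota> \<otimes> \<omega>\<close> and \<open>\<omega> \<otimes> \<iota>\<close> of a linear functional \<open>\<omega>\<close>.\<close>

definition slice2 :: "('b::complex_vector \<Rightarrow> complex) \<Rightarrow> ('a::complex_vector, 'b) tensor \<Rightarrow> 'a"
  where "slice2 \<omega> = tensor_lift (\<lambda>a b. \<omega> b *\<^sub>C a)"

definition slice1 :: "('a::complex_vector \<Rightarrow> complex) \<Rightarrow> ('a, 'b::complex_vector) tensor \<Rightarrow> 'b"
  where "slice1 \<omega> = tensor_lift (\<lambda>a b. \<omega> a *\<^sub>C b)"

lemma slice_bilinear:
  "clinear \<omega> \<Longrightarrow> bilinear_map (\<lambda>a b. \<omega> b *\<^sub>C a)"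
  "clinear \<omega> \<Longrightarrow> bilinear_map (\<lambda>a b. \<omega> a *\<^sub>C b)"
  unfolding bilinear_map_def clinear_iff
  by (auto simp: scaleC_right_distrib scaleC_left_distrib scaleC_scaleC scaleC_complex_def mult.commute)

lemma slice2: "clinear \<omega> \<Longrightarrow> clinear (slice2 \<omega>)" "clinear \<omega> \<Longrightarrow> slice2 \<omega> (a \<otimes> b) = \<omega> b *\<^sub>C a"
  by (simp_all add: slice2_def slice_bilinear clinear_tensor_lift)

lemma slice1: "clinear \<omega> \<Longrightarrow> clinear (slice1 \<omega>)" "clinear \<omega> \<Longrightarrow> slice1 \<omega> (a \<otimes> b) = \<omega> a *\<^sub>C b"
  by (simp_all add: slice1_def slice_bilinear clinear_tensor_lift)

definition coord :: "'a::complex_vector \<Rightarrow> 'a \<Rightarrow> complex"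
  where "coord e v = cvec.representation (cvec.extend_basis {}) v e"

lemma clinear_coord: "clinear (coord e)"
  by (rule clinearI) (simp_all add: coord_def cvec.representation_add cvec.representation_scale
      cvec.independent_extend_basis cvec.independent_empty cvec.span_extend_basis scaleC_complex_def)

lemma coord_expansion: "finite {e. coord e v \<noteq> 0}" "(\<Sum>e | coord e v \<noteq> 0. coord e v *\<^sub>C e) = v"
  by (simp_all add: coord_def cvec.finite_representation cvec.sum_nonzero_representation_eq
      cvec.independent_extend_basis cvec.independent_empty cvec.span_extend_basis)

lemma functional_separates:
  assumes "\<And>\<omega>. clinear \<omega> \<Longrightarrow> \<omega> v = (0::complex)" shows "v = 0"
  using coord_expansion(2)[of v] assms[OF clinear_coord] by simp

lemma slice2_separates:
  assumes "\<And>\<omega>. clinear \<omega> \<Longrightarrow> slice2 \<omega> x = 0" shows "x = 0"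
proof -
  have "\<exists>F. finite F \<and> (\<forall>F'. finite F' \<longrightarrow> F \<subseteq> F' \<longrightarrow> (\<Sum>e\<in>F'. slice2 (coord e) x \<otimes> e) = x)"
  proof (induction x rule: tensor_induct)
    case (pair a b)
    have "(\<Sum>e\<in>F'. slice2 (coord e) (a \<otimes> b) \<otimes> e) = a \<otimes> b"
      if F': "finite F'" "{e. coord e b \<noteq> 0} \<subseteq> F'" for F'
    proof -
      have "(\<Sum>e\<in>F'. slice2 (coord e) (a \<otimes> b) \<otimes> e) = (\<Sum>e\<in>F'. a \<otimes> (coord e b *\<^sub>C e))"
        by (intro sum.cong) (simp_all add: slice2 clinear_coord tensor_pair_linear)
      also have "\<dots> = a \<otimes> (\<Sum>e\<in>F'. coord e b *\<^sub>C e)"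
        by (rule clinear_sum[symmetric]) (simp add: clinear_iff tensor_pair_linear)
      also have "(\<Sum>e\<in>F'. coord e b *\<^sub>C e) = (\<Sum>e | coord e b \<noteq> 0. coord e b *\<^sub>C e)"
        using F' by (intro sum.mono_neutral_right) auto
      finally show ?thesis by (simp add: coord_expansion)
    qed
    then show ?case by (intro exI[of _ "{e. coord e b \<noteq> 0}"]) (simp add: coord_expansion(1))
  next
    case (add x y)
    from add(1) obtain F where F: "finite F"
      "\<forall>F'. finite F' \<longrightarrow> F \<subseteq> F' \<longrightarrow> (\<Sum>e\<in>F'. slice2 (coord e) x \<otimes> e) = x" by (elim exE conjE)
    from add(2) obtain G where G: "finite G"
      "\<forall>F'. finite F' \<longrightarrow> G \<subseteq> F' \<longrightarrow> (\<Sum>e\<in>F'. slice2 (coord e) y \<otimes> e) = y" by (elim exE conjE)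
    have "slice2 (coord e) (x + y) \<otimes> e = slice2 (coord e) x \<otimes> e + slice2 (coord e) y \<otimes> e" for e
      by (simp add: tensor_pair_linear clinear_add[OF slice2(1)] clinear_coord)
    then show ?case
      using F G by (intro exI[of _ "F \<union> G"]) (simp add: sum.distrib)
  qed
  then obtain F where "(\<Sum>e\<in>F. slice2 (coord e) x \<otimes> e) = x" by (elim exE conjE allE impE) auto
  then show ?thesis
    using assms[OF clinear_coord] by (simp add: bilinear_map_0[OF bilinear_tensor_pair])
qed

lemma functional_slices:
  assumes "clinear \<rho>" "clinear \<omega>" shows "\<omega> (slice1 \<rho> x) = \<rho> (slice2 \<omega> x)"
proof (induction x rule: tensor_induct)
  case (pair a b)
  show ?case
    by (simp only: slice1(2)[OF assms(1)] slice2(2)[OF assms(2)] clinear_scale[OF assms(1)]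
        clinear_scale[OF assms(2)]) (simp add: scaleC_complex_def)
qed (simp add: assms clinear_add[OF assms(1)] clinear_add[OF assms(2)]
    clinear_add[OF slice1(1)] clinear_add[OF slice2(1)])

lemma slice1_separates:
  fixes x :: "('a::complex_vector, 'b::complex_vector) tensor"
  assumes "\<And>\<rho>. clinear \<rho> \<Longrightarrow> slice1 \<rho> x = 0" shows "x = 0"
proof (rule slice2_separates, rule functional_separates)
  fix \<omega> :: "'b \<Rightarrow> complex" and \<rho> :: "'a \<Rightarrow> complex" assume "clinear \<omega>" "clinear \<rho>"
  then show "\<rho> (slice2 \<omega> x) = 0"
    using functional_slices[of \<rho> \<omega> x] assms[of \<rho>] clinear_0[of \<omega>] by simp
qed

instance tensor :: (nondegenerate_algebra, nondegenerate_algebra) nondegenerate_algebra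
proof
  fix x :: "('a, 'b) tensor"
  have lin: "clinear (\<lambda>b. \<omega> (b * d))" "clinear (\<lambda>b. \<omega> (d * b))"
    if "clinear \<omega>" for \<omega> :: "'b \<Rightarrow> complex" and d
    using that by (auto simp: clinear_iff algebra_simps scaleC_mult_left scaleC_mult_right)
  show "x = 0" if z: "\<And>y. x * y = 0"
  proof (rule slice1_separates, rule nondegenerate_left, rule functional_separates)
    fix \<rho> :: "'a \<Rightarrow> complex" and d and \<omega> :: "'b \<Rightarrow> complex"
    assume \<rho>: "clinear \<rho>" and \<omega>: "clinear \<omega>"
    have "slice2 (\<lambda>b. \<omega> (b * d)) x = 0"
    proof (rule nondegenerate_left)
      fix c
      have "slice2 (\<lambda>b. \<omega> (b * d)) x * c = slice2 \<omega> (x * (c \<otimes> d))"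
        by (induction x rule: tensor_induct) (simp_all add: slice2 lin \<omega> times_tensor_pair
            clinear_add[OF slice2(1)] algebra_simps scaleC_mult_left)
      then show "slice2 (\<lambda>b. \<omega> (b * d)) x * c = 0" by (simp add: z clinear_0[OF slice2(1)[OF \<omega>]])
    qed
    then show "\<omega> (slice1 \<rho> x * d) = 0"
      using functional_slices[OF \<rho> lin(1)[OF \<omega>, of d], of x] by (simp add: clinear_0[OF \<rho>])
  qed
  show "x = 0" if z: "\<And>y. y * x = 0"
  proof (rule slice1_separates, rule nondegenerate_right, rule functional_separates)
    fix \<rho> :: "'a \<Rightarrow> complex" and d and \<omega> :: "'b \<Rightarrow> complex"
    assume \<rho>: "clinear \<rho>" and \<omega>: "clinear \<omega>"
    have "slice2 (\<lambda>b. \<omega> (d * b)) x = 0"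
    proof (rule nondegenerate_right)
      fix c
      have "c * slice2 (\<lambda>b. \<omega> (d * b)) x = slice2 \<omega> ((c \<otimes> d) * x)"
        by (induction x rule: tensor_induct) (simp_all add: slice2 lin \<omega> times_tensor_pair
            clinear_add[OF slice2(1)] algebra_simps scaleC_mult_right)
      then show "c * slice2 (\<lambda>b. \<omega> (d * b)) x = 0" by (simp add: z clinear_0[OF slice2(1)[OF \<omega>]])
    qed
    then show "\<omega> (d * slice1 \<rho> x) = 0"
      using functional_slices[OF \<rho> lin(2)[OF \<omega>, of d], of x] by (simp add: clinear_0[OF \<rho>])
  qed
qed

section \<open>Multiplier algebras\<close>

text \<open>A multiplier \<open>m\<close> is represented by the pair of maps \<open>L a = m a\<close> and \<open>R a = a m\<close>.\<close>

typedef (overloaded) 'a multiplier =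
  "{(L :: 'a::complex_algebra \<Rightarrow> 'a, R :: 'a \<Rightarrow> 'a).
     clinear L \<and> clinear R \<and> (\<forall>a b. L (a * b) = L a * b) \<and> (\<forall>a b. R (a * b) = a * R b)
     \<and> (\<forall>a b. a * L b = R a * b)}"
  by (rule exI[of _ "(\<lambda>x. x, \<lambda>x. x)"]) simp

setup_lifting type_definition_multiplier

lift_definition mult_left :: "'a::complex_algebra multiplier \<Rightarrow> 'a \<Rightarrow> 'a" (infixr \<open>\<rhd>\<close> 70) is fst .

lift_definition mult_right :: "'a::complex_algebra \<Rightarrow> 'a multiplier \<Rightarrow> 'a" (infixl \<open>\<lhd>\<close> 70) is
  "\<lambda>a m. snd m a" .

lemma multiplier_eqI:
  "(\<And>a. m \<rhd> a = n \<rhd> a) \<Longrightarrow> (\<And>a. a \<lhd> m = a \<lhd> n) \<Longrightarrow> m = n"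
  by transfer (auto intro!: prod_eqI)

lemma multiplier_linear: "clinear (\<lambda>a. m \<rhd> a)" "clinear (\<lambda>a. a \<lhd> m)"
  and multiplier_assoc: "m \<rhd> (a * b) = (m \<rhd> a) * b" "(a * b) \<lhd> m = a * (b \<lhd> m)"
    "a * (m \<rhd> b) = (a \<lhd> m) * b"
  by (transfer, auto)+

instantiation multiplier :: (complex_algebra) "{complex_algebra, monoid_mult}"
begin
lift_definition zero_multiplier :: "'a multiplier" is "(\<lambda>_. 0, \<lambda>_. 0)"
  by (auto simp: clinear_iff)
lift_definition one_multiplier :: "'a multiplier" is "(\<lambda>a. a, \<lambda>a. a)"
  by auto
lift_definition plus_multiplier :: "'a multiplier \<Rightarrow> 'a multiplier \<Rightarrow> 'a multiplier" is
  "\<lambda>(L, R) (L', R'). (\<lambda>a. L a + L' a, \<lambda>a. R a + R' a)"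
  by (auto simp: clinear_iff algebra_simps scaleC_right_distrib)
lift_definition uminus_multiplier :: "'a multiplier \<Rightarrow> 'a multiplier" is
  "\<lambda>(L, R). (\<lambda>a. - L a, \<lambda>a. - R a)"
  by (auto simp: clinear_iff)
lift_definition minus_multiplier :: "'a multiplier \<Rightarrow> 'a multiplier \<Rightarrow> 'a multiplier" is
  "\<lambda>(L, R) (L', R'). (\<lambda>a. L a - L' a, \<lambda>a. R a - R' a)"
  by (auto simp: clinear_iff algebra_simps cvec.scale_right_diff_distrib)
lift_definition scaleC_multiplier :: "complex \<Rightarrow> 'a multiplier \<Rightarrow> 'a multiplier" is
  "\<lambda>c (L, R). (\<lambda>a. c *\<^sub>C L a, \<lambda>a. c *\<^sub>C R a)"
  by (auto simp: clinear_iff scaleC_right_distrib scaleC_scaleC mult.commute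
      scaleC_mult_left scaleC_mult_right)
lift_definition times_multiplier :: "'a multiplier \<Rightarrow> 'a multiplier \<Rightarrow> 'a multiplier" is
  "\<lambda>(L, R) (L', R'). (\<lambda>a. L (L' a), \<lambda>a. R' (R a))"
  by (auto simp: clinear_iff)
instance
proof
  fix m n k :: "'a multiplier" and c d :: complex
  show "m + n + k = m + (n + k)" "0 + m = m" "- m + m = 0" "m - n = m + - n" "m + n = n + m"
    by (transfer; auto simp: algebra_simps)+
  show "c *\<^sub>C (m + n) = c *\<^sub>C m + c *\<^sub>C n" "(c + d) *\<^sub>C m = c *\<^sub>C m + d *\<^sub>C m"
    "c *\<^sub>C d *\<^sub>C m = (c * d) *\<^sub>C m" "1 *\<^sub>C m = m"
    by (transfer; auto simp: scaleC_right_distrib scaleC_left_distrib scaleC_scaleC scaleC_one)+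
  show "m * n * k = m * (n * k)" "1 * m = m" "m * 1 = m"
    by (transfer; auto)+
  show "(m + n) * k = m * k + n * k" "m * (n + k) = m * n + m * k"
    "c *\<^sub>C m * n = c *\<^sub>C (m * n)" "m * c *\<^sub>C n = c *\<^sub>C (m * n)"
    by (transfer; auto simp: clinear_iff fun_eq_iff)+
qed
end

lemma multiplier_simps [simp]:
  "(m * n) \<rhd> a = m \<rhd> (n \<rhd> a)" "a \<lhd> (m * n) = (a \<lhd> m) \<lhd> n" "1 \<rhd> a = a" "a \<lhd> 1 = a"
  "(m + n) \<rhd> a = m \<rhd> a + n \<rhd> a" "a \<lhd> (m + n) = a \<lhd> m + a \<lhd> n"
  "(c *\<^sub>C m) \<rhd> a = c *\<^sub>C (m \<rhd> a)" "a \<lhd> (c *\<^sub>C m) = c *\<^sub>C (a \<lhd> m)"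
  by (transfer; auto)+

definition multiplier_inverse :: "'a::complex_algebra multiplier \<Rightarrow> 'a multiplier"
  where "multiplier_inverse m = (THE n. m * n = 1 \<and> n * m = 1)"

lift_definition mult_embed :: "'a::complex_algebra \<Rightarrow> 'a multiplier" is
  "\<lambda>a. (\<lambda>b. a * b, \<lambda>b. b * a)"
  by (auto simp: clinear_mult_left clinear_mult_right mult.assoc)

lemma mult_embed_simps [simp]: "mult_embed a \<rhd> b = a * b" "b \<lhd> mult_embed a = b * a"
  by (transfer, simp)+

lemma inj_mult_embed: "inj (mult_embed :: 'a::nondegenerate_algebra \<Rightarrow> _)"
proof (rule injI)
  fix a b :: 'a assume "mult_embed a = mult_embed b"
  then have "a * y = b * y" for y by (metis mult_embed_simps(1))
  then have "(a - b) * y = 0" for y by (simp add: left_diff_distrib)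
  then have "a - b = 0" by (rule nondegenerate_left)
  then show "a = b" by simp
qed

text \<open>\<open>element m\<close> is the multiplier \<open>m\<close> regarded as an element of the algebra, meaningful when
  \<open>m \<in> range mult_embed\<close>.\<close>

definition element :: "'a::nondegenerate_algebra multiplier \<Rightarrow> 'a"
  where "element = inv mult_embed"

lemma element_embed [simp]: "element (mult_embed a) = a"
  by (simp add: element_def inj_mult_embed)

lift_definition mult_tensor ::
    "'a::complex_algebra multiplier \<Rightarrow> 'b::complex_algebra multiplier \<Rightarrow> ('a, 'b) tensor multiplier"
  is "\<lambda>(L, R) (L', R'). (tensor_map L L', tensor_map R R')"
proof (clarsimp, intro conjI allI)
  fix L R :: "'a \<Rightarrow> 'a" and L' R' :: "'b \<Rightarrow> 'b" and x y :: "('a, 'b) tensor"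
  assume lin: "clinear L" "clinear R" "clinear L'" "clinear R'"
    and mod: "\<forall>a b. L (a * b) = L a * b" "\<forall>a b. R (a * b) = a * R b" "\<forall>a b. a * L b = R a * b"
      "\<forall>a b. L' (a * b) = L' a * b" "\<forall>a b. R' (a * b) = a * R' b" "\<forall>a b. a * L' b = R' a * b"
  show LL: "clinear (tensor_map L L')" and RR: "clinear (tensor_map R R')"
    using lin by (simp_all add: clinear_tensor_map)
  note add = clinear_add[OF LL] clinear_add[OF RR] algebra_simps
  have "tensor_map L L' ((a \<otimes> b) * y) = tensor_map L L' (a \<otimes> b) * y" for a b
    using lin mod by (induction y rule: tensor_induct) (simp_all add: times_tensor_pair add)
  then show "tensor_map L L' (x * y) = tensor_map L L' x * y"
    by (induction x rule: tensor_induct) (simp_all add: add)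
  have "tensor_map R R' ((a \<otimes> b) * y) = (a \<otimes> b) * tensor_map R R' y" for a b
    using lin mod by (induction y rule: tensor_induct) (simp_all add: times_tensor_pair add)
  then show "tensor_map R R' (x * y) = x * tensor_map R R' y"
    by (induction x rule: tensor_induct) (simp_all add: add)
  have "(a \<otimes> b) * tensor_map L L' y = tensor_map R R' (a \<otimes> b) * y" for a b
    using lin mod by (induction y rule: tensor_induct) (simp_all add: times_tensor_pair add)
  then show "x * tensor_map L L' y = tensor_map R R' x * y"
    by (induction x rule: tensor_induct) (simp_all add: add)
qed

lemma mult_tensor_pair [simp]:
  "mult_tensor m n \<rhd> (a \<otimes> b) = (m \<rhd> a) \<otimes> (n \<rhd> b)"
  "(a \<otimes> b) \<lhd> mult_tensor m n = (a \<lhd> m) \<otimes> (b \<lhd> n)"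
  by (transfer; auto)+

abbreviation leg1 :: "'a::complex_algebra \<Rightarrow> ('a, 'b::complex_algebra) tensor multiplier"
  where "leg1 a \<equiv> mult_tensor (mult_embed a) 1"

abbreviation leg2 :: "'b::complex_algebra \<Rightarrow> ('a::complex_algebra, 'b) tensor multiplier"
  where "leg2 b \<equiv> mult_tensor 1 (mult_embed b)"

lemma tensor_flip_times: "tensor_flip (x * y) = tensor_flip x * tensor_flip y"
proof -
  have "tensor_flip ((a \<otimes> b) * y) = tensor_flip (a \<otimes> b) * tensor_flip y" for a b
    by (induction y rule: tensor_induct)
      (simp_all add: times_tensor_pair clinear_add[OF clinear_tensor_flip] algebra_simps)
  then show ?thesis
    by (induction x rule: tensor_induct)
      (simp_all add: clinear_add[OF clinear_tensor_flip] algebra_simps)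
qed

lift_definition mult_flip ::
    "('a::complex_algebra, 'b::complex_algebra) tensor multiplier \<Rightarrow> ('b, 'a) tensor multiplier"
  is "\<lambda>(L, R). (\<lambda>x. tensor_flip (L (tensor_flip x)), \<lambda>x. tensor_flip (R (tensor_flip x)))"
proof (clarsimp, intro conjI allI)
  fix L R :: "('a, 'b) tensor \<Rightarrow> ('a, 'b) tensor" and x y :: "('b, 'a) tensor"
  assume *: "clinear L" "clinear R" "\<forall>a b. L (a * b) = L a * b" "\<forall>a b. R (a * b) = a * R b"
    "\<forall>a b. a * L b = R a * b"
  show "clinear (\<lambda>x. tensor_flip (L (tensor_flip x)))" "clinear (\<lambda>x. tensor_flip (R (tensor_flip x)))"
    using * by (auto simp: clinear_iff clinear_add[OF clinear_tensor_flip]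
        clinear_scale[OF clinear_tensor_flip])
  show "tensor_flip (L (tensor_flip (x * y))) = tensor_flip (L (tensor_flip x)) * y"
    "tensor_flip (R (tensor_flip (x * y))) = x * tensor_flip (R (tensor_flip y))"
    using * by (simp_all add: tensor_flip_times)
  show "x * tensor_flip (L (tensor_flip y)) = tensor_flip (R (tensor_flip x)) * y"
    using * by (metis tensor_flip_flip tensor_flip_times)
qed

text \<open>Slices of multipliers: for \<open>x \<in> M(A \<otimes> A)\<close> such that \<open>x (b \<otimes> 1)\<close> and \<open>(b \<otimes> 1) x\<close> lie in
  \<open>A \<otimes> A\<close> for all \<open>b\<close>, the multiplier \<open>(\<iota> \<otimes> \<omega>)(x)\<close> is given by
  \<open>(\<iota> \<otimes> \<omega>)(x) b = (\<iota> \<otimes> \<omega>)(x (b \<otimes> 1))\<close> and \<open>b (\<iota> \<otimes> \<omega>)(x) = (\<iota> \<otimes> \<omega>)((b \<otimes> 1) x)\<close>.\<close>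

definition mult_slice2 ::
    "('b::nondegenerate_algebra \<Rightarrow> complex) \<Rightarrow> ('a::nondegenerate_algebra, 'b) tensor multiplier \<Rightarrow> 'a multiplier"
  where "mult_slice2 \<omega> x = Abs_multiplier
    (\<lambda>b. slice2 \<omega> (element (x * leg1 b)), \<lambda>b. slice2 \<omega> (element (leg1 b * x)))"

definition mult_slice1 ::
    "('a::nondegenerate_algebra \<Rightarrow> complex) \<Rightarrow> ('a, 'b::nondegenerate_algebra) tensor multiplier \<Rightarrow> 'b multiplier"
  where "mult_slice1 \<omega> x = Abs_multiplier
    (\<lambda>b. slice1 \<omega> (element (x * leg2 b)), \<lambda>b. slice1 \<omega> (element (leg2 b * x)))"

lemma mult_embed_multiplier: "mult_embed (m \<rhd> z) = m * mult_embed z" "mult_embed (z \<lhd> m) = mult_embed z * m"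
  by (rule multiplier_eqI, simp_all add: multiplier_assoc)+

lemma embed_element: "m \<in> range mult_embed \<Longrightarrow> mult_embed (element m) = m"
  by auto

lemma leg_linear:
  "leg1 (a + b) = leg1 a + leg1 b" "leg1 (c *\<^sub>C a) = c *\<^sub>C leg1 a" "leg1 (a * b) = leg1 a * leg1 b"
  "leg2 (a + b) = leg2 a + leg2 b" "leg2 (c *\<^sub>C a) = c *\<^sub>C leg2 a" "leg2 (a * b) = leg2 a * leg2 b"
  by (rule multiplier_eqI; rule tensor_lift_unique;
      (simp add: algebra_simps tensor_pair_linear scaleC_mult_left scaleC_mult_right)?;
      (auto simp: clinear_iff clinear_add[OF multiplier_linear(1)] clinear_add[OF multiplier_linear(2)]
        clinear_scale[OF multiplier_linear(1)] clinear_scale[OF multiplier_linear(2)]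
        scaleC_right_distrib scaleC_scaleC mult.commute algebra_simps; fail)?)+

lemma slice_leg:
  assumes "clinear \<omega>"
  shows "slice2 \<omega> (leg1 a \<rhd> z) = a * slice2 \<omega> z" "slice2 \<omega> (z \<lhd> leg1 a) = slice2 \<omega> z * a"
    "slice1 \<omega> (leg2 a' \<rhd> y) = a' * slice1 \<omega> y" "slice1 \<omega> (y \<lhd> leg2 a') = slice1 \<omega> y * a'"
  by (induction z rule: tensor_induct; induction y rule: tensor_induct;
      simp add: assms slice1 slice2 algebra_simps clinear_add[OF multiplier_linear(1)]
        clinear_add[OF multiplier_linear(2)] clinear_add[OF slice1(1)[OF assms]]
        clinear_add[OF slice2(1)[OF assms]] scaleC_mult_left scaleC_mult_right)+

lemma element_simps:
  assumes "m \<in> range mult_embed" "n \<in> range mult_embed"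
  shows "element (m + n) = element m + element n" "element (c *\<^sub>C m) = c *\<^sub>C element m"
    "element (k * m) = k \<rhd> element m" "element (m * k) = element m \<lhd> k"
proof -
  obtain a b where [simp]: "m = mult_embed a" "n = mult_embed b" using assms by blast
  have "mult_embed a + mult_embed b = mult_embed (a + b)" "c *\<^sub>C mult_embed a = mult_embed (c *\<^sub>C a)"
    by (rule multiplier_eqI, simp_all add: algebra_simps scaleC_mult_left scaleC_mult_right)+
  then show "element (m + n) = element m + element n" "element (c *\<^sub>C m) = c *\<^sub>C element m"
    "element (k * m) = k \<rhd> element m" "element (m * k) = element m \<lhd> k"
    by (simp_all add: mult_embed_multiplier[symmetric])
qed

lemma mult_slice2:
  assumes \<omega>: "clinear \<omega>"
    and cover: "\<And>b. x * leg1 b \<in> range mult_embed" "\<And>b. leg1 b * x \<in> range mult_embed"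
  shows "mult_slice2 \<omega> x \<rhd> b = slice2 \<omega> (element (x * leg1 b))"
    "b \<lhd> mult_slice2 \<omega> x = slice2 \<omega> (element (leg1 b * x))"
proof -
  note e = element_simps[OF cover(1) cover(1)] element_simps[OF cover(2) cover(2)]
    clinear_add[OF slice2(1)[OF \<omega>]] clinear_scale[OF slice2(1)[OF \<omega>]]
  have "leg1 a \<rhd> element (x * leg1 b) = element (leg1 a * x) \<lhd> leg1 b" for a b
    by (simp add: e(3)[symmetric] e(8)[symmetric] mult.assoc)
  then have "a * slice2 \<omega> (element (x * leg1 b)) = slice2 \<omega> (element (leg1 a * x)) * b" for a b
    by (simp add: slice_leg[OF \<omega>, symmetric])
  then have "(\<lambda>b. slice2 \<omega> (element (x * leg1 b)), \<lambda>b. slice2 \<omega> (element (leg1 b * x)))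
    \<in> {(L, R). clinear L \<and> clinear R \<and> (\<forall>a b. L (a * b) = L a * b) \<and> (\<forall>a b. R (a * b) = a * R b)
     \<and> (\<forall>a b. a * L b = R a * b)}"
    by (simp add: clinear_iff leg_linear distrib_left distrib_right scaleC_mult_left scaleC_mult_right e
        mult.assoc[symmetric, of x] slice_leg[OF \<omega>] mult.assoc[of "leg1 _" "leg1 _"])
  then show "mult_slice2 \<omega> x \<rhd> b = slice2 \<omega> (element (x * leg1 b))"
    "b \<lhd> mult_slice2 \<omega> x = slice2 \<omega> (element (leg1 b * x))"
    by (simp_all add: mult_slice2_def mult_left.rep_eq mult_right.rep_eq Abs_multiplier_inverse)
qed

lemma mult_slice1:
  assumes \<omega>: "clinear \<omega>"
    and cover: "\<And>b. x * leg2 b \<in> range mult_embed" "\<And>b. leg2 b * x \<in> range mult_embed"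
  shows "mult_slice1 \<omega> x \<rhd> b = slice1 \<omega> (element (x * leg2 b))"
    "b \<lhd> mult_slice1 \<omega> x = slice1 \<omega> (element (leg2 b * x))"
proof -
  note e = element_simps[OF cover(1) cover(1)] element_simps[OF cover(2) cover(2)]
    clinear_add[OF slice1(1)[OF \<omega>]] clinear_scale[OF slice1(1)[OF \<omega>]]
  have "leg2 a \<rhd> element (x * leg2 b) = element (leg2 a * x) \<lhd> leg2 b" for a b
    by (simp add: e(3)[symmetric] e(8)[symmetric] mult.assoc)
  then have "a * slice1 \<omega> (element (x * leg2 b)) = slice1 \<omega> (element (leg2 a * x)) * b" for a b
    by (simp add: slice_leg[OF \<omega>, symmetric])
  then have "(\<lambda>b. slice1 \<omega> (element (x * leg2 b)), \<lambda>b. slice1 \<omega> (element (leg2 b * x)))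
    \<in> {(L, R). clinear L \<and> clinear R \<and> (\<forall>a b. L (a * b) = L a * b) \<and> (\<forall>a b. R (a * b) = a * R b)
     \<and> (\<forall>a b. a * L b = R a * b)}"
    by (simp add: clinear_iff leg_linear distrib_left distrib_right scaleC_mult_left scaleC_mult_right e
        mult.assoc[symmetric, of x] slice_leg[OF \<omega>] mult.assoc[of "leg2 _" "leg2 _"])
  then show "mult_slice1 \<omega> x \<rhd> b = slice1 \<omega> (element (x * leg2 b))"
    "b \<lhd> mult_slice1 \<omega> x = slice1 \<omega> (element (leg2 b * x))"
    by (simp_all add: mult_slice1_def mult_left.rep_eq mult_right.rep_eq Abs_multiplier_inverse)
qed

section \<open>Algebraic quantum groups\<close>

definition canonical1 :: "('a::nondegenerate_algebra \<Rightarrow> ('a, 'a) tensor multiplier) \<Rightarrow> ('a, 'a) tensor \<Rightarrow> ('a, 'a) tensor"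
  where "canonical1 \<Delta> = tensor_lift (\<lambda>a a'. element (\<Delta> a * leg2 a'))"

definition canonical2 :: "('a::nondegenerate_algebra \<Rightarrow> ('a, 'a) tensor multiplier) \<Rightarrow> ('a, 'a) tensor \<Rightarrow> ('a, 'a) tensor"
  where "canonical2 \<Delta> = tensor_lift (\<lambda>a a'. element (leg1 a * \<Delta> a'))"

text \<open>In the coassociativity condition, \<open>(a \<otimes> 1 \<otimes> 1) (\<Delta> \<otimes> \<iota>)(x)\<close> for \<open>x \<in> A \<otimes> A\<close> is the image
  of \<open>x\<close> under \<open>p \<otimes> q \<mapsto> (a \<otimes> 1) \<Delta>(p) \<otimes> q\<close>, and similarly for the other side.\<close>

locale regular_multiplier_Hopf_algebra =
  fixes \<Delta> :: "'a::nondegenerate_algebra \<Rightarrow> ('a, 'a) tensor multiplier"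
  assumes comult_linear: "clinear \<Delta>"
    and comult_mult: "\<Delta> (a * b) = \<Delta> a * \<Delta> b"
    and comult_cover:
      "\<Delta> a * leg2 a' \<in> range mult_embed" "leg1 a * \<Delta> a' \<in> range mult_embed"
      "\<Delta> a * leg1 a' \<in> range mult_embed" "leg2 a * \<Delta> a' \<in> range mult_embed"
    and coassociative:
      "tensor_assoc (tensor_map (\<lambda>p. element (leg1 a * \<Delta> p)) (\<lambda>q. q) (element (\<Delta> c * leg2 a')))
       = tensor_map (\<lambda>p. p) (\<lambda>q. element (\<Delta> q * leg2 a')) (element (leg1 a * \<Delta> c))"
    and canonical_bij:
      "bij (canonical1 \<Delta>)" "bij (canonical2 \<Delta>)"
      "bij (canonical1 (mult_flip \<circ> \<Delta>))" "bij (canonical2 (mult_flip \<circ> \<Delta>))"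

definition counit ::
    "('a::nondegenerate_algebra \<Rightarrow> ('a, 'a) tensor multiplier) \<Rightarrow> ('a \<Rightarrow> complex) \<Rightarrow> bool"
  where "counit \<Delta> \<epsilon> \<longleftrightarrow> clinear \<epsilon> \<and> (\<forall>a b. \<epsilon> (a * b) = \<epsilon> a * \<epsilon> b)
    \<and> (\<forall>a b. slice1 \<epsilon> (element (\<Delta> a * leg2 b)) = a * b)
    \<and> (\<forall>a b. slice2 \<epsilon> (element (leg1 a * \<Delta> b)) = a * b)"

definition antipode ::
    "('a::nondegenerate_algebra \<Rightarrow> ('a, 'a) tensor multiplier) \<Rightarrow> ('a \<Rightarrow> complex) \<Rightarrow> ('a \<Rightarrow> 'a) \<Rightarrow> bool"
  where "antipode \<Delta> \<epsilon> S \<longleftrightarrow> clinear S \<and> bij S \<and> (\<forall>a b. S (a * b) = S b * S a)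
    \<and> (\<forall>a b. tensor_lift (\<lambda>p q. S p * q) (element (\<Delta> a * leg2 b)) = \<epsilon> a *\<^sub>C b)
    \<and> (\<forall>a b. tensor_lift (\<lambda>p q. p * S q) (element (leg1 a * \<Delta> b)) = \<epsilon> b *\<^sub>C a)"

definition left_integral ::
    "('a::nondegenerate_algebra \<Rightarrow> ('a, 'a) tensor multiplier) \<Rightarrow> ('a \<Rightarrow> complex) \<Rightarrow> bool"
  where "left_integral \<Delta> \<phi> \<longleftrightarrow> clinear \<phi> \<and> (\<exists>a. \<phi> a \<noteq> 0) \<and> (\<forall>a. mult_slice2 \<phi> (\<Delta> a) = \<phi> a *\<^sub>C 1)"

definition right_integral ::
    "('a::nondegenerate_algebra \<Rightarrow> ('a, 'a) tensor multiplier) \<Rightarrow> ('a \<Rightarrow> complex) \<Rightarrow> bool"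
  where "right_integral \<Delta> \<psi> \<longleftrightarrow> clinear \<psi> \<and> (\<exists>a. \<psi> a \<noteq> 0) \<and> (\<forall>a. mult_slice1 \<psi> (\<Delta> a) = \<psi> a *\<^sub>C 1)"

locale algebraic_quantum_group = regular_multiplier_Hopf_algebra +
  assumes left_integral_exists: "\<exists>\<phi>. left_integral \<Delta> \<phi>"
    and right_integral_exists: "\<exists>\<psi>. right_integral \<Delta> \<psi>"

definition modular_element ::
    "('a::nondegenerate_algebra \<Rightarrow> complex) \<Rightarrow> ('a \<Rightarrow> 'a) \<Rightarrow> 'a multiplier \<Rightarrow> bool"
  where "modular_element \<phi> S \<delta> \<longleftrightarrow>
    (\<exists>\<delta>'. \<delta> * \<delta>' = 1 \<and> \<delta>' * \<delta> = 1) \<and> (\<forall>a. \<phi> (S a) = \<phi> (a \<lhd> \<delta>))"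

section \<open>The dual\<close>

text \<open>Elements of the dual are functionals on \<open>A\<close>, and the pairing \<open>\<langle>a, b\<rangle>\<close> is application \<open>b a\<close>.\<close>

definition dual_element :: "('a::nondegenerate_algebra \<Rightarrow> complex) \<Rightarrow> 'a \<Rightarrow> 'a \<Rightarrow> complex"
  where "dual_element \<phi> c = (\<lambda>x. \<phi> (x * c))"

definition dual :: "('a::nondegenerate_algebra \<Rightarrow> complex) \<Rightarrow> ('a \<Rightarrow> complex) set"
  where "dual \<phi> = range (dual_element \<phi>)"

text \<open>For \<open>b = \<phi>(\<sqdot> c)\<close> and \<open>b' = \<phi>(\<sqdot> c')\<close>, the pairing of \<open>m \<in> M(A \<otimes> A)\<close> with \<open>b \<otimes> b'\<close> is
  \<open>(\<phi> \<otimes> \<phi>)(m (c \<otimes> c'))\<close>. The inverses used here and in the dual integrals are unambiguous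
  on \<open>dual \<phi>\<close> because integrals are faithful.\<close>

definition dual_pairing2 ::
    "('a::nondegenerate_algebra \<Rightarrow> complex) \<Rightarrow> ('a, 'a) tensor multiplier \<Rightarrow> ('a \<Rightarrow> complex) \<Rightarrow> ('a \<Rightarrow> complex) \<Rightarrow> complex"
  where "dual_pairing2 \<phi> m b b' =
    tensor_lift (\<lambda>x y. \<phi> x * \<phi> y) (m \<rhd> (inv (dual_element \<phi>) b \<otimes> inv (dual_element \<phi>) b'))"

definition dual_mult ::
    "('a::nondegenerate_algebra \<Rightarrow> ('a, 'a) tensor multiplier) \<Rightarrow> ('a \<Rightarrow> complex)
      \<Rightarrow> ('a \<Rightarrow> complex) \<Rightarrow> ('a \<Rightarrow> complex) \<Rightarrow> 'a \<Rightarrow> complex"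
  where "dual_mult \<Delta> \<phi> b b' = (\<lambda>a. dual_pairing2 \<phi> (\<Delta> a) b b')"

definition dual_right_integral ::
    "('a::nondegenerate_algebra \<Rightarrow> complex) \<Rightarrow> ('a \<Rightarrow> complex) \<Rightarrow> ('a \<Rightarrow> complex) \<Rightarrow> complex"
  where "dual_right_integral \<phi> \<epsilon> b = \<epsilon> (inv (dual_element \<phi>) b)"

definition dual_left_integral ::
    "('a::nondegenerate_algebra \<Rightarrow> complex) \<Rightarrow> ('a \<Rightarrow> 'a) \<Rightarrow> ('a \<Rightarrow> complex) \<Rightarrow> ('a \<Rightarrow> complex) \<Rightarrow> complex"
  where "dual_left_integral \<psi> S \<epsilon> b = \<epsilon> (inv (\<lambda>a x. \<psi> (S x * a)) b)"

text \<open>Addition and scalar multiplication of functionals are pointwise.\<close>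

definition dual_automorphism ::
    "('a::nondegenerate_algebra \<Rightarrow> ('a, 'a) tensor multiplier) \<Rightarrow> ('a \<Rightarrow> complex)
      \<Rightarrow> (('a \<Rightarrow> complex) \<Rightarrow> ('a \<Rightarrow> complex)) \<Rightarrow> bool"
  where "dual_automorphism \<Delta> \<phi> \<sigma> \<longleftrightarrow> bij_betw \<sigma> (dual \<phi>) (dual \<phi>)
    \<and> (\<forall>b\<in>dual \<phi>. \<forall>b'\<in>dual \<phi>. \<sigma> (\<lambda>x. b x + b' x) = (\<lambda>x. \<sigma> b x + \<sigma> b' x))
    \<and> (\<forall>c. \<forall>b\<in>dual \<phi>. \<sigma> (\<lambda>x. c * b x) = (\<lambda>x. c * \<sigma> b x))
    \<and> (\<forall>b\<in>dual \<phi>. \<forall>b'\<in>dual \<phi>. \<sigma> (dual_mult \<Delta> \<phi> b b') = dual_mult \<Delta> \<phi> (\<sigma> b) (\<sigma> b'))"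

definition modular_automorphism ::
    "('a::nondegenerate_algebra \<Rightarrow> ('a, 'a) tensor multiplier) \<Rightarrow> ('a \<Rightarrow> complex)
      \<Rightarrow> (('a \<Rightarrow> complex) \<Rightarrow> complex) \<Rightarrow> (('a \<Rightarrow> complex) \<Rightarrow> ('a \<Rightarrow> complex)) \<Rightarrow> bool"
  where "modular_automorphism \<Delta> \<phi> \<theta> \<sigma> \<longleftrightarrow> dual_automorphism \<Delta> \<phi> \<sigma>
    \<and> (\<forall>b\<in>dual \<phi>. \<forall>b'\<in>dual \<phi>. \<theta> (dual_mult \<Delta> \<phi> b b') = \<theta> (dual_mult \<Delta> \<phi> b' (\<sigma> b)))"

end

theory Submission
  imports Defs
begin

text \<open>Write \<open>\<Delta>(a) = a\<^sub>1 \<otimes> a\<^sub>2\<close> and \<open>\<psi> = \<phi> \<circ> S\<close>. Everything rests on the strong left invariance of \<open>\<phi>\<close>,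
  \<open>S(x\<^sub>1) \<phi>(x\<^sub>2 c) = c\<^sub>1 \<phi>(x c\<^sub>2)\<close>, which follows from left invariance and the antipode identity
  (\<open>strong_left_invariance\<close>). It has three consequences. It makes \<open>\<phi>\<close> faithful on both sides, because
  the elements annihilated by \<open>\<phi>\<close> form a one-sided ideal on which the counit must vanish. It
  forces \<open>\<Delta>(S(a)) = S(a\<^sub>2) \<otimes> S(a\<^sub>1)\<close> (\<open>antipode_comult_T2\<close>), since the elements
  \<open>x\<^sub>1 \<phi>(x\<^sub>2 c)\<close> span \<open>A\<close>. Transported through \<open>S\<close>, it becomes the strong right invariance
  \<open>S(x\<^sub>2) \<psi>(c x\<^sub>1) = c\<^sub>2 \<psi>(c\<^sub>1 x)\<close>.

  Strong invariance evaluates products in the dual. For \<open>b' = \<phi>(\<sqdot> c)\<close> it moves the coproduct from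
  the argument of \<open>b b'\<close> to \<open>c\<close>, and the right integral of the dual takes the value \<open>b(S\<^sup>-\<^sup>1(c))\<close>
  on \<open>b b'\<close>. If \<open>b'\<close> is written as \<open>\<psi>(S(\<sqdot>) a)\<close>, the same device shows that the left integral of
  the dual takes the value \<open>b(a)\<close>. For \<open>b = \<phi>(\<sqdot> d)\<close> the defining property
  of the two modular automorphisms thus becomes an identity in \<open>A\<close>. For \<open>\<sigma>(b) = \<psi>(S(\<sqdot>) e)\<close> it reads
  \<open>\<phi>(a d) = \<psi>(S(e) a)\<close> for all \<open>a\<close>; putting \<open>a = S\<^sup>2(x) \<delta>\<^sup>-\<^sup>1\<close> and using \<open>\<psi>(y \<delta>\<^sup>-\<^sup>1) = \<phi>(y)\<close> gives the
  first formula. For \<open>\<sigma>'(b) = \<phi>(\<sqdot> e)\<close> it reads \<open>\<phi>(S\<^sup>-\<^sup>1(c) d) = \<phi>(S\<^sup>-\<^sup>1(e) c)\<close> for all \<open>c\<close>; putting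
  \<open>c = S\<^sup>-\<^sup>1(x) \<delta>\<close> gives \<open>\<sigma>'(b)(x) = b(S\<^sup>-\<^sup>1(S\<^sup>-\<^sup>1(x) \<delta>))\<close>, and the second formula needs in addition
  \<open>S(\<delta>) = \<delta>\<^sup>-\<^sup>1\<close>. This holds because \<open>\<delta>\<close> is group-like: the two strong invariance formulas,
  compared through \<open>\<psi> = \<phi>(\<sqdot> \<delta>)\<close>, say that \<open>\<Delta>(d \<delta>) = \<Delta>(d) (\<delta> \<otimes> \<delta>)\<close> (\<open>modular_group_like\<close>).

  Since \<open>\<Delta>(a)\<close> is only a multiplier, each Sweedler expression has to be covered by an element of \<open>A\<close>
  in all legs but one. The proofs therefore work with \<open>\<Delta>\<close> multiplied by an element in one leg, and
  remove auxiliary factors by non-degeneracy.\<close>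

section \<open>Slices and cancellation\<close>

lemma tensor_lift_comp:
  assumes "clinear g" "bilinear_map f"
  shows "g (tensor_lift f z) = tensor_lift (\<lambda>p q. g (f p q)) z"
proof (induction z rule: tensor_induct)
  case (pair a b)
  then show ?case using assms by (simp add: clinear_bilinear_comp)
next
  case (add x y)
  then show ?case
    by (simp add: clinear_add[OF assms(1)] clinear_add[OF clinear_tensor_lift[OF assms(2)]]
        clinear_add[OF clinear_tensor_lift[OF clinear_bilinear_comp[OF assms]]])
qed

lemma leg1_cancel:
  assumes "\<And>t. leg1 t \<rhd> z = leg1 t \<rhd> z'" shows "z = (z' :: ('a::nondegenerate_algebra, 'b::nondegenerate_algebra) tensor)"
proof -
  have "z - z' = 0"
  proof (rule slice2_separates, rule nondegenerate_right)
    fix \<omega> :: "'b \<Rightarrow> complex" and t assume \<omega>: "clinear \<omega>"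
    have "t * slice2 \<omega> z = t * slice2 \<omega> z'" using assms[of t] by (metis slice_leg(1) \<omega>)
    then show "t * slice2 \<omega> (z - z') = 0"
      using clinear_add[OF slice2(1)[OF \<omega>], of "z - z'" z'] by (simp add: algebra_simps)
  qed
  then show ?thesis by simp
qed

lemma leg1_cancel_right:
  assumes "\<And>t. z \<lhd> leg1 t = z' \<lhd> leg1 t" shows "z = (z' :: ('a::nondegenerate_algebra, 'b::nondegenerate_algebra) tensor)"
proof -
  have "z - z' = 0"
  proof (rule slice2_separates, rule nondegenerate_left)
    fix \<omega> :: "'b \<Rightarrow> complex" and t assume \<omega>: "clinear \<omega>"
    have "slice2 \<omega> z * t = slice2 \<omega> z' * t" using assms[of t] by (metis slice_leg(2) \<omega>)
    then show "slice2 \<omega> (z - z') * t = 0"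
      using clinear_add[OF slice2(1)[OF \<omega>], of "z - z'" z'] by (simp add: algebra_simps)
  qed
  then show ?thesis by simp
qed

lemma mult_cancel_left: assumes "\<And>t. t * x = t * y" shows "x = (y :: 'a::nondegenerate_algebra)"
proof -
  have "x - y = 0" by (rule nondegenerate_right) (simp add: assms right_diff_distrib)
  then show ?thesis by simp
qed

lemma mult_cancel_right: assumes "\<And>t. x * t = y * t" shows "x = (y :: 'a::nondegenerate_algebra)"
proof -
  have "x - y = 0" by (rule nondegenerate_left) (simp add: assms left_diff_distrib)
  then show ?thesis by simp
qed

lemma functional_eqI: assumes "\<And>\<omega>. clinear \<omega> \<Longrightarrow> \<omega> v = (\<omega> w :: complex)" shows "v = w"
proof -
  have "v - w = 0"
  proof (rule functional_separates)
    fix \<omega> :: "'a \<Rightarrow> complex" assume \<omega>: "clinear \<omega>"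
    show "\<omega> (v - w) = 0" using assms[OF \<omega>] clinear_add[OF \<omega>, of "v - w" w] by simp
  qed
  then show ?thesis by simp
qed

lemma slice_shift:
  assumes "clinear \<omega>"
  shows "slice1 \<omega> (leg1 a \<rhd> z) = slice1 (\<lambda>p. \<omega> (a * p)) z"
    "slice1 \<omega> (z \<lhd> leg1 a) = slice1 (\<lambda>p. \<omega> (p * a)) z"
    "slice2 \<omega> (leg2 b \<rhd> z) = slice2 (\<lambda>p. \<omega> (b * p)) z"
    "slice2 \<omega> (z \<lhd> leg2 b) = slice2 (\<lambda>p. \<omega> (p * b)) z"
proof -
  have l: "clinear (\<lambda>p. \<omega> (c * p))" "clinear (\<lambda>p. \<omega> (p * c))" for c
    using assms by (auto simp: clinear_iff algebra_simps scaleC_mult_left scaleC_mult_right)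
  show "slice1 \<omega> (leg1 a \<rhd> z) = slice1 (\<lambda>p. \<omega> (a * p)) z"
    "slice1 \<omega> (z \<lhd> leg1 a) = slice1 (\<lambda>p. \<omega> (p * a)) z"
    "slice2 \<omega> (leg2 b \<rhd> z) = slice2 (\<lambda>p. \<omega> (b * p)) z"
    "slice2 \<omega> (z \<lhd> leg2 b) = slice2 (\<lambda>p. \<omega> (p * b)) z"
    by (induction z rule: tensor_induct; simp add: slice1 slice2 l assms
        clinear_add[OF slice1(1)] clinear_add[OF slice2(1)] clinear_add[OF multiplier_linear(1)]
        clinear_add[OF multiplier_linear(2)])+
qed

lemma bilinear_mapI:
  assumes "\<And>x y b. f (x + y) b = f x b + f y b" "\<And>c x b. f (c *\<^sub>C x) b = c *\<^sub>C f x b"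
    "\<And>a x y. f a (x + y) = f a x + f a y" "\<And>c a x. f a (c *\<^sub>C x) = c *\<^sub>C f a x"
  shows "bilinear_map f"
  using assms by (simp add: bilinear_map_def clinear_iff)

text \<open>The basis elements \<open>e\<close> of the first leg are linearly independent, so that a condition on all
  first-leg slices of \<open>z\<close> becomes a condition on the second components \<open>slice1 (coord e) z\<close>. This
  turns such conditions into statements about \<open>z\<close> itself.\<close>

lemma tensor_decomposition:
  "\<exists>F. finite F \<and> z = (\<Sum>e\<in>F. e \<otimes> slice1 (coord e) z)"
proof -
  \<comment> \<open>The expansion is claimed for all larger index sets, so that the sets for two summands can be merged.\<close>
  have "\<exists>F. finite F \<and> (\<forall>F'. finite F' \<longrightarrow> F \<subseteq> F' \<longrightarrow> (\<Sum>e\<in>F'. e \<otimes> slice1 (coord e) z) = z)"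
  proof (induction z rule: tensor_induct)
    case (pair a b)
    have "(\<Sum>e\<in>F'. e \<otimes> slice1 (coord e) (a \<otimes> b)) = a \<otimes> b"
      if F': "finite F'" "{e. coord e a \<noteq> 0} \<subseteq> F'" for F'
    proof -
      have "(\<Sum>e\<in>F'. e \<otimes> slice1 (coord e) (a \<otimes> b)) = (\<Sum>e\<in>F'. (coord e a *\<^sub>C e) \<otimes> b)"
        by (intro sum.cong) (simp_all add: slice1 clinear_coord tensor_pair_linear)
      also have "\<dots> = (\<Sum>e\<in>F'. coord e a *\<^sub>C e) \<otimes> b"
        by (rule clinear_sum[symmetric, where f = "\<lambda>x. x \<otimes> b"]) (simp add: clinear_iff tensor_pair_linear)
      also have "(\<Sum>e\<in>F'. coord e a *\<^sub>C e) = (\<Sum>e | coord e a \<noteq> 0. coord e a *\<^sub>C e)"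
        using F' by (intro sum.mono_neutral_right) auto
      finally show ?thesis by (simp add: coord_expansion)
    qed
    then show ?case by (intro exI[of _ "{e. coord e a \<noteq> 0}"]) (simp add: coord_expansion(1))
  next
    case (add x y)
    from add(1) obtain F where F: "finite F"
      "\<forall>F'. finite F' \<longrightarrow> F \<subseteq> F' \<longrightarrow> (\<Sum>e\<in>F'. e \<otimes> slice1 (coord e) x) = x" by (elim exE conjE)
    from add(2) obtain G where G: "finite G"
      "\<forall>F'. finite F' \<longrightarrow> G \<subseteq> F' \<longrightarrow> (\<Sum>e\<in>F'. e \<otimes> slice1 (coord e) y) = y" by (elim exE conjE)
    have "e \<otimes> slice1 (coord e) (x + y) = e \<otimes> slice1 (coord e) x + e \<otimes> slice1 (coord e) y" for e
      by (simp add: tensor_pair_linear clinear_add[OF slice1(1)] clinear_coord)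
    then show ?case
      using F G by (intro exI[of _ "F \<union> G"]) (simp add: sum.distrib)
  qed
  then obtain F where "finite F" "(\<Sum>e\<in>F. e \<otimes> slice1 (coord e) z) = z" by (elim exE conjE allE impE) auto
  then show ?thesis by (intro exI[of _ F]) simp
qed

lemma tensor_lift_eq_0:
  assumes f: "bilinear_map f" and 0: "\<And>p \<rho>. clinear \<rho> \<Longrightarrow> f p (slice1 \<rho> z) = 0"
  shows "tensor_lift f z = 0"
proof -
  obtain F where "z = (\<Sum>e\<in>F. e \<otimes> slice1 (coord e) z)" using tensor_decomposition by blast
  then have "tensor_lift f z = (\<Sum>e\<in>F. tensor_lift f (e \<otimes> slice1 (coord e) z))"
    by (metis clinear_sum[OF clinear_tensor_lift[OF f]])
  then show ?thesis by (simp add: f 0 clinear_coord)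
qed

lemma mult_tensor_mult: "mult_tensor m n * mult_tensor m' n' = mult_tensor (m * m') (n * n')"
proof (rule multiplier_eqI)
  fix z
  show "(mult_tensor m n * mult_tensor m' n') \<rhd> z = mult_tensor (m * m') (n * n') \<rhd> z"
    by (induction z rule: tensor_induct) (simp_all add: clinear_add[OF multiplier_linear(1)])
  show "z \<lhd> (mult_tensor m n * mult_tensor m' n') = z \<lhd> mult_tensor (m * m') (n * n')"
    by (induction z rule: tensor_induct) (simp_all add: clinear_add[OF multiplier_linear(2)])
qed

lemma mult_embed_tensor_pair: "mult_embed (b \<otimes> c) = mult_tensor (mult_embed b) (mult_embed c)"
proof (rule multiplier_eqI)
  fix z
  show "mult_embed (b \<otimes> c) \<rhd> z = mult_tensor (mult_embed b) (mult_embed c) \<rhd> z"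
    by (induction z rule: tensor_induct)
      (simp_all add: clinear_add[OF multiplier_linear(1)] times_tensor_pair distrib_left)
  show "z \<lhd> mult_embed (b \<otimes> c) = z \<lhd> mult_tensor (mult_embed b) (mult_embed c)"
    by (induction z rule: tensor_induct)
      (simp_all add: clinear_add[OF multiplier_linear(2)] times_tensor_pair distrib_right)
qed

lemma legs_commute: "leg1 a * leg2 b = leg2 b * leg1 a"
  by (simp add: mult_tensor_mult)

lemma element_scale: "m \<in> range mult_embed \<Longrightarrow> element (c *\<^sub>C m) = c *\<^sub>C element m"
  and element_mult: "m \<in> range mult_embed \<Longrightarrow> element (k * m) = k \<rhd> element m"
    "m \<in> range mult_embed \<Longrightarrow> element (m * k) = element m \<lhd> k"
  using element_simps(2-4)[of m m] by blast+

text \<open>The form in which bijectivity of the canonical maps is applied: a property that is closed under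
  sums holds on \<open>A \<otimes> A\<close> as soon as it holds on the covered coproducts.\<close>

lemma surj_canonical_induct:
  assumes "surj (tensor_lift f)" "bilinear_map f"
    and "\<And>a b. P (f a b)" "\<And>x y. P x \<Longrightarrow> P y \<Longrightarrow> P (x + y)"
  shows "P z"
proof -
  obtain y where "z = tensor_lift f y" using assms(1) by (rule surjE)
  moreover have "P (tensor_lift f y)"
    by (induction y rule: tensor_induct)
      (simp_all add: assms clinear_add[OF clinear_tensor_lift[OF assms(2)]])
  ultimately show ?thesis by simp
qed

lemma slice_add:
  "clinear \<omega> \<Longrightarrow> slice1 \<omega> (x + y) = slice1 \<omega> x + slice1 \<omega> y"
  "clinear \<omega> \<Longrightarrow> slice1 \<omega> (k *\<^sub>C x) = k *\<^sub>C slice1 \<omega> x"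
  "clinear \<omega> \<Longrightarrow> slice2 \<omega> (x' + y') = slice2 \<omega> x' + slice2 \<omega> y'"
  "clinear \<omega> \<Longrightarrow> slice2 \<omega> (k *\<^sub>C x') = k *\<^sub>C slice2 \<omega> x'"
  by (simp_all add: clinear_add[OF slice1(1)] clinear_add[OF slice2(1)] clinear_scale[OF slice1(1)] clinear_scale[OF slice2(1)])

lemma tensor_map_add:
  assumes "clinear f" "clinear g"
  shows "tensor_map f g (x + y) = tensor_map f g x + tensor_map f g y"
  by (simp add: clinear_add[OF clinear_tensor_map] assms)

lemma multiplier_commute: "m \<rhd> (z \<lhd> n) = (m \<rhd> z) \<lhd> n"
  for z :: "'x::nondegenerate_algebra"
  by (rule mult_cancel_left) (simp only: multiplier_assoc(2)[symmetric] multiplier_assoc(3))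

lemma tensor_map_plus:
  assumes "clinear f" "clinear g" "clinear h"
  shows "tensor_map f (\<lambda>q. g q + h q) w = tensor_map f g w + tensor_map f h w"
proof -
  have "clinear (\<lambda>q. g q + h q)" using assms(2,3) by (auto simp: clinear_iff scaleC_right_distrib algebra_simps)
  with assms show ?thesis
    by (induction w rule: tensor_induct) (simp_all add: tensor_map_add tensor_pair_linear)
qed

text \<open>All iterated slices are brought to the form \<open>\<rho> (slice2 \<omega> _)\<close>, so that a calculation with two
  functionals reduces to comparing elements of \<open>A \<otimes> A\<close>.\<close>

lemma functional_tensor_mult:
  assumes "clinear \<rho>" "clinear \<omega>"
  shows "\<rho> (slice2 \<omega> z * x) = \<rho> (slice2 \<omega> (z \<lhd> leg1 x))" "\<omega> (slice1 \<rho> z * y) = \<rho> (slice2 \<omega> (z \<lhd> leg2 y))"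
    "\<rho> (x * slice2 \<omega> z) = \<rho> (slice2 \<omega> (leg1 x \<rhd> z))" "\<omega> (y * slice1 \<rho> z) = \<rho> (slice2 \<omega> (leg2 y \<rhd> z))"
  by (simp_all only: slice_leg(1,2)[OF assms(2)])
    (simp_all only: functional_slices[OF assms, symmetric] slice_leg(3,4)[OF assms(1)])

section \<open>The covered coproducts\<close>

locale regular_Hopf_with_antipode = regular_multiplier_Hopf_algebra \<Delta>
  for \<Delta> :: "'a::nondegenerate_algebra \<Rightarrow> ('a, 'a) tensor multiplier" +
  fixes \<epsilon> :: "'a \<Rightarrow> complex" and S :: "'a \<Rightarrow> 'a"
  assumes is_counit: "counit \<Delta> \<epsilon>" and is_antipode: "antipode \<Delta> \<epsilon> S"
begin

text \<open>The four ways of covering one leg of \<open>\<Delta>\<close>: \<open>T1 a b = a\<^sub>1 \<otimes> a\<^sub>2 b\<close>, \<open>T2 a b = a b\<^sub>1 \<otimes> b\<^sub>2\<close>,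
  \<open>T3 a b = a\<^sub>1 b \<otimes> a\<^sub>2\<close> and \<open>T4 a b = b\<^sub>1 \<otimes> a b\<^sub>2\<close>.\<close>

definition T1 :: "'a \<Rightarrow> 'a \<Rightarrow> ('a, 'a) tensor" where "T1 a b = element (\<Delta> a * leg2 b)"
definition T2 :: "'a \<Rightarrow> 'a \<Rightarrow> ('a, 'a) tensor" where "T2 a b = element (leg1 a * \<Delta> b)"
definition T3 :: "'a \<Rightarrow> 'a \<Rightarrow> ('a, 'a) tensor" where "T3 a b = element (\<Delta> a * leg1 b)"
definition T4 :: "'a \<Rightarrow> 'a \<Rightarrow> ('a, 'a) tensor" where "T4 a b = element (leg2 a * \<Delta> b)"

lemmas T_defs = T1_def T2_def T3_def T4_def

lemma mult_embed_T:
  "mult_embed (T1 a b) = \<Delta> a * leg2 b" "mult_embed (T2 a b) = leg1 a * \<Delta> b"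
  "mult_embed (T3 a b) = \<Delta> a * leg1 b" "mult_embed (T4 a b) = leg2 a * \<Delta> b"
  by (simp_all only: T_defs embed_element comult_cover)

lemma T_bilinear:
  "T1 (a + a') b = T1 a b + T1 a' b" "T1 (k *\<^sub>C a) b = k *\<^sub>C T1 a b"
  "T1 a (b + b') = T1 a b + T1 a b'" "T1 a (k *\<^sub>C b) = k *\<^sub>C T1 a b"
  "T2 (a + a') b = T2 a b + T2 a' b" "T2 (k *\<^sub>C a) b = k *\<^sub>C T2 a b"
  "T2 a (b + b') = T2 a b + T2 a b'" "T2 a (k *\<^sub>C b) = k *\<^sub>C T2 a b"
  "T3 (a + a') b = T3 a b + T3 a' b" "T3 (k *\<^sub>C a) b = k *\<^sub>C T3 a b"
  "T3 a (b + b') = T3 a b + T3 a b'" "T3 a (k *\<^sub>C b) = k *\<^sub>C T3 a b"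
  "T4 (a + a') b = T4 a b + T4 a' b" "T4 (k *\<^sub>C a) b = k *\<^sub>C T4 a b"
  "T4 a (b + b') = T4 a b + T4 a b'" "T4 a (k *\<^sub>C b) = k *\<^sub>C T4 a b"
  unfolding T_defs
  by (simp_all add: clinear_add[OF comult_linear] clinear_scale[OF comult_linear] leg_linear
      distrib_left distrib_right scaleC_mult_left scaleC_mult_right element_simps(1) element_scale comult_cover)

text \<open>Covering a second leg makes expressions with different first covers comparable; for instance
  both sides of the first equation are \<open>t x\<^sub>1 \<otimes> x\<^sub>2 c\<close>.\<close>

lemma T_mult:
  "leg1 t \<rhd> T1 x c = T2 t x \<lhd> leg2 c"
  "leg1 t \<rhd> T3 x c = T2 t x \<lhd> leg1 c"
  "leg1 t \<rhd> T4 x c = leg2 x \<rhd> T2 t c"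
  "leg2 t \<rhd> T1 x c = T4 t x \<lhd> leg2 c"
  "leg2 t \<rhd> T3 x c = T4 t x \<lhd> leg1 c"
  "leg1 t \<rhd> T2 s x = T2 (t * s) x"
  unfolding T_defs
  by (simp_all add: comult_cover element_mult[symmetric] mult.assoc leg_linear)
    (simp only: mult.assoc[symmetric] legs_commute)

lemma T_acts:
  "\<Delta> x \<rhd> (b \<otimes> c) = T1 x c \<lhd> leg1 b" "\<Delta> x \<rhd> (b \<otimes> c) = T3 x b \<lhd> leg2 c"
  "T3 (x * y) c = \<Delta> x \<rhd> T3 y c"
  "(b \<otimes> c) \<lhd> \<Delta> x = leg2 c \<rhd> T2 b x"
proof -
  have "m \<rhd> z = element (m * mult_embed z)" "z \<lhd> m = element (mult_embed z * m)"
    for m and z :: "('a, 'a) tensor" by (simp_all add: mult_embed_multiplier[symmetric])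
  then show "\<Delta> x \<rhd> (b \<otimes> c) = T1 x c \<lhd> leg1 b" "\<Delta> x \<rhd> (b \<otimes> c) = T3 x b \<lhd> leg2 c"
    "(b \<otimes> c) \<lhd> \<Delta> x = leg2 c \<rhd> T2 b x" "T3 (x * y) c = \<Delta> x \<rhd> T3 y c"
    unfolding T_defs
    by (simp_all add: embed_element comult_cover mult_embed_tensor_pair mult.assoc mult_tensor_mult
      comult_mult) (simp add: mult.assoc[symmetric] mult_tensor_mult)
qed

lemma counit_linear: "clinear \<epsilon>"
  and counit_mult: "\<epsilon> (a * b) = \<epsilon> a * \<epsilon> b"
  and counit_T1: "slice1 \<epsilon> (T1 a b) = a * b"
  and counit_T2: "slice2 \<epsilon> (T2 a b) = a * b"
  using is_counit by (auto simp: counit_def T_defs)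

lemma antipode_linear: "clinear S"
  and antipode_bij: "bij S"
  and antipode_mult: "S (a * b) = S b * S a"
  and antipode_T1: "tensor_lift (\<lambda>p q. S p * q) (T1 a b) = \<epsilon> a *\<^sub>C b"
  and antipode_T2: "tensor_lift (\<lambda>p q. p * S q) (T2 a b) = \<epsilon> b *\<^sub>C a"
  using is_antipode by (auto simp: antipode_def T_defs)

abbreviation (input) Sinv :: "'a \<Rightarrow> 'a" where "Sinv \<equiv> inv S"

lemma S_Sinv [simp]: "S (Sinv a) = a" "Sinv (S a) = a"
  using antipode_bij by (simp_all add: bij_is_surj surj_f_inv_f bij_is_inj)

lemma S_eq_iff [simp]: "S a = S b \<longleftrightarrow> a = b"
  using antipode_bij by (simp add: bij_is_inj inj_eq)

lemmas S_add = clinear_add[OF antipode_linear]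
lemmas S_scale = clinear_scale[OF antipode_linear]

lemma Sinv_linear: "clinear Sinv"
proof (rule clinearI)
  fix x y k
  have "S (Sinv (x + y)) = S (Sinv x + Sinv y)" by (simp add: S_add)
  then show "Sinv (x + y) = Sinv x + Sinv y" by (simp only: S_eq_iff)
  have "S (Sinv (k *\<^sub>C x)) = S (k *\<^sub>C Sinv x)" by (simp add: S_scale)
  then show "Sinv (k *\<^sub>C x) = k *\<^sub>C Sinv x" by (simp only: S_eq_iff)
qed

lemma Sinv_mult: "Sinv (a * b) = Sinv b * Sinv a"
  by (subst S_eq_iff[symmetric]) (simp add: antipode_mult)

lemmas lin_simps = T_bilinear S_add S_scale clinear_add[OF Sinv_linear] clinear_scale[OF Sinv_linear]
  clinear_add[OF counit_linear] clinear_scale[OF counit_linear]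
  clinear_add[OF multiplier_linear(1)] clinear_scale[OF multiplier_linear(1)]
  clinear_add[OF multiplier_linear(2)] clinear_scale[OF multiplier_linear(2)]
  tensor_pair_linear scaleC_mult_left scaleC_mult_right distrib_left distrib_right
  scaleC_right_distrib scaleC_left_distrib scaleC_scaleC

text \<open>The identity \<open>S(c\<^sub>1) c\<^sub>2 = \<epsilon>(c) 1\<close> with the cover in the first leg instead of the second: the
  factor \<open>t\<close> leaves \<open>S(c\<^sub>1 t) = S(t) S(c\<^sub>1)\<close> on the left, where it does not disturb the cancellation.\<close>

lemma antipode_T3: "tensor_lift (\<lambda>p q. S p * q) (T3 c t) = \<epsilon> c *\<^sub>C S t"
proof (rule mult_cancel_right)
  fix b
  have m: "bilinear_map (\<lambda>p q. S p * q)" by (rule bilinear_mapI; simp only: lin_simps)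
  note add = clinear_add[OF clinear_tensor_lift[OF m]] clinear_add[OF multiplier_linear(2)]
  have "tensor_lift (\<lambda>p q. S p * q) z * b = tensor_lift (\<lambda>p q. S p * q) (z \<lhd> leg2 b)" for z
    by (induction z rule: tensor_induct) (simp_all add: m add distrib_right mult.assoc)
  moreover have "T3 c t \<lhd> leg2 b = T1 c b \<lhd> leg1 t" by (metis T_acts(1,2))
  moreover have "tensor_lift (\<lambda>p q. S p * q) (z \<lhd> leg1 t) = S t * tensor_lift (\<lambda>p q. S p * q) z" for z
    by (induction z rule: tensor_induct) (simp_all add: m add distrib_left mult.assoc antipode_mult)
  ultimately show "tensor_lift (\<lambda>p q. S p * q) (T3 c t) * b = (\<epsilon> c *\<^sub>C S t) * b"
    by (simp add: antipode_T1 scaleC_mult_left scaleC_mult_right)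
qed

lemma T_bilinear_map:
  "bilinear_map T1" "bilinear_map T2" "bilinear_map T3" "bilinear_map T4"
  by (intro bilinear_mapI; simp add: T_bilinear)+

text \<open>\<open>T3\<close> and \<open>T4\<close> are the canonical maps of the opposite coproduct, followed by the flip.\<close>

lemma T_surj:
  "surj (tensor_lift T1)" "surj (tensor_lift T2)" "surj (tensor_lift T3)" "surj (tensor_lift T4)"
proof -
  have m: "mult_flip m \<rhd> z = tensor_flip (m \<rhd> tensor_flip z)"
    "z \<lhd> mult_flip m = tensor_flip (tensor_flip z \<lhd> m)" for m :: "('a, 'a) tensor multiplier" and z
    by (transfer; auto)+
  have flip_leg: "mult_flip m * leg2 c = mult_flip (m * leg1 c)"
    "leg1 c * mult_flip m = mult_flip (leg2 c * m)" for m :: "('a, 'a) tensor multiplier" and c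
  proof -
    have f: "tensor_flip (leg2 c \<rhd> z) = leg1 c \<rhd> tensor_flip z"
      "tensor_flip (z \<lhd> leg2 c) = tensor_flip z \<lhd> leg1 c"
      "tensor_flip (leg1 c \<rhd> z) = leg2 c \<rhd> tensor_flip z"
      "tensor_flip (z \<lhd> leg1 c) = tensor_flip z \<lhd> leg2 c" for z :: "('a, 'a) tensor"
      by (induction z rule: tensor_induct; simp add: clinear_add[OF multiplier_linear(1)]
        clinear_add[OF multiplier_linear(2)] clinear_add[OF clinear_tensor_flip])+
    show "mult_flip m * leg2 c = mult_flip (m * leg1 c)"
      "leg1 c * mult_flip m = mult_flip (leg2 c * m)"
      by (rule multiplier_eqI; simp add: m f)+
  qed
  have flip_element: "element (mult_flip m) = tensor_flip (element m)" if "m \<in> range mult_embed"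
    for m :: "('a, 'a) tensor multiplier"
  proof -
    have "mult_flip (mult_embed z) = mult_embed (tensor_flip z)" for z :: "('a, 'a) tensor"
      by (rule multiplier_eqI; simp add: m tensor_flip_times)
    then show ?thesis using that by auto
  qed
  have e: "element (mult_flip (\<Delta> a) * leg2 b) = tensor_flip (T3 a b)"
    "element (leg1 a * mult_flip (\<Delta> b)) = tensor_flip (T4 a b)" for a b
    by (simp_all add: flip_leg flip_element comult_cover T_defs)
  have "canonical1 (mult_flip \<circ> \<Delta>) = tensor_lift (\<lambda>a b. tensor_flip (T3 a b))"
    "canonical2 (mult_flip \<circ> \<Delta>) = tensor_lift (\<lambda>a b. tensor_flip (T4 a b))"
    by (simp_all only: canonical1_def canonical2_def o_apply e)
  then have c: "canonical1 (mult_flip \<circ> \<Delta>) y = tensor_flip (tensor_lift T3 y)"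
    "canonical2 (mult_flip \<circ> \<Delta>) y = tensor_flip (tensor_lift T4 y)" for y
    using tensor_lift_comp[OF clinear_tensor_flip T_bilinear_map(3)]
        tensor_lift_comp[OF clinear_tensor_flip T_bilinear_map(4)] by metis+
  show "surj (tensor_lift T1)" "surj (tensor_lift T2)"
    using canonical_bij(1,2)[THEN bij_is_surj] unfolding canonical1_def canonical2_def T_defs[abs_def]
    by simp_all
  have *: "surj g" if sf: "surj f" and fg: "\<And>y. f y = tensor_flip (g y)"
    for f g :: "('a, 'a) tensor \<Rightarrow> ('a, 'a) tensor"
  proof (unfold surj_def, rule allI)
    fix z
    from sf obtain y where "tensor_flip z = f y" by (rule surjE)
    then have "tensor_flip (tensor_flip z) = tensor_flip (tensor_flip (g y))" by (simp only: fg)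
    then show "\<exists>y. z = g y" by auto
  qed
  show "surj (tensor_lift T3)"
    by (rule *[OF canonical_bij(3)[THEN bij_is_surj] c(1)])
  show "surj (tensor_lift T4)"
    by (rule *[OF canonical_bij(4)[THEN bij_is_surj] c(2)])
qed

lemmas T1_induct = surj_canonical_induct[OF T_surj(1) T_bilinear_map(1), case_names pair add]
lemmas T2_induct = surj_canonical_induct[OF T_surj(2) T_bilinear_map(2), case_names pair add]
lemmas T3_induct = surj_canonical_induct[OF T_surj(3) T_bilinear_map(3), case_names pair add]
lemmas T4_induct = surj_canonical_induct[OF T_surj(4) T_bilinear_map(4), case_names pair add]

section \<open>Coassociativity with other covers\<close>

text \<open>The coassociativity axiom for \<open>t c\<^sub>1 \<otimes> c\<^sub>2 \<otimes> c\<^sub>3 v\<close>, with \<open>\<omega>\<close> applied to the third leg. It says that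
  \<open>\<Delta>(s) = c\<^sub>1 \<otimes> c\<^sub>2 \<omega>(c\<^sub>3 v)\<close> for \<open>s = c\<^sub>1 \<omega>(c\<^sub>2 v)\<close>.\<close>

lemma coassoc_T2:
  assumes \<omega>: "clinear \<omega>"
  shows "T2 t (slice2 \<omega> (T1 c v)) = tensor_map (\<lambda>p. p) (\<lambda>q. slice2 \<omega> (T1 q v)) (T2 t c)"
proof -
  define sl :: "('a, ('a, 'a) tensor) tensor \<Rightarrow> ('a, 'a) tensor"
    where "sl = tensor_map (\<lambda>p. p) (slice2 \<omega>)"
  have sl: "clinear sl" unfolding sl_def by (intro clinear_tensor_map slice2(1) \<omega> clinear_id)
  have b0: "bilinear_map (\<lambda>a b. a \<otimes> b \<otimes> c)" for c :: 'a
    by (rule bilinear_mapI; simp only: lin_simps)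
  have b: "bilinear_map (\<lambda>x c. tensor_lift (\<lambda>a b. a \<otimes> b \<otimes> c) x :: ('a, ('a, 'a) tensor) tensor)"
  proof (intro bilinear_mapI)
    fix x :: "('a, 'a) tensor" and c d :: 'a and k
    note e = tensor_lift_pair[OF b0] clinear_add[OF clinear_tensor_lift[OF b0]]
    show "tensor_lift (\<lambda>a b. a \<otimes> b \<otimes> (c + d)) x = tensor_lift (\<lambda>a b. a \<otimes> b \<otimes> c) x + tensor_lift (\<lambda>a b. a \<otimes> b \<otimes> d) x"
    proof (induction x rule: tensor_induct)
      case (add x y)
      then show ?case by (simp only: e) (simp add: ac_simps)
    qed (simp only: e, simp only: lin_simps)
    show "tensor_lift (\<lambda>a b. a \<otimes> b \<otimes> (k *\<^sub>C d)) x = k *\<^sub>C tensor_lift (\<lambda>a b. a \<otimes> b \<otimes> d) x"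
    proof (induction x rule: tensor_induct)
      case (add x y)
      then show ?case by (simp only: e scaleC_right_distrib)
    qed (simp only: e, simp only: lin_simps)
  qed (simp_all only: clinear_add[OF clinear_tensor_lift[OF b0]] clinear_scale[OF clinear_tensor_lift[OF b0]])
  have assoc: "clinear (tensor_assoc :: (('a,'a) tensor, 'a) tensor \<Rightarrow> _)"
    "tensor_assoc (w \<otimes> q) = tensor_lift (\<lambda>a b. a \<otimes> b \<otimes> q) w" for w :: "('a, 'a) tensor" and q :: 'a
    unfolding tensor_assoc_def by (simp_all add: b clinear_tensor_lift)
  have sa: "sl (tensor_assoc z) = slice2 \<omega> z" for z
  proof (induction z rule: tensor_induct)
    case (pair w q)
    show ?case
    proof (induction w rule: tensor_induct)
      case (pair a b)
      show ?case by (simp only: assoc(2) tensor_lift_pair[OF b0]) (simp add: sl_def slice2 \<omega> lin_simps)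
    next
      case (add x y)
      then show ?case by (simp only: lin_simps clinear_add[OF assoc(1)] clinear_add[OF sl] slice_add \<omega>)
    qed
  qed (simp add: clinear_add[OF assoc(1)] clinear_add[OF sl] slice_add \<omega>)
  have t: "clinear (T2 t)" "clinear (\<lambda>q. T1 q v)" "clinear (\<lambda>q. slice2 \<omega> (T1 q v))"
    by (auto intro!: clinearI simp: lin_simps slice_add \<omega>)
  have 1: "sl (tensor_assoc (tensor_map (T2 t) (\<lambda>q. q) z)) = T2 t (slice2 \<omega> z)" for z
    unfolding sa by (induction z rule: tensor_induct)
      (simp_all add: t slice2 \<omega> lin_simps tensor_map_add slice_add)
  have 2: "sl (tensor_map (\<lambda>p. p) (\<lambda>q. T1 q v) z) = tensor_map (\<lambda>p. p) (\<lambda>q. slice2 \<omega> (T1 q v)) z" for z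
    unfolding sl_def by (induction z rule: tensor_induct)
      (simp_all add: t slice2 \<omega> tensor_map_add)
  have 3: "tensor_assoc (tensor_map (T2 t) (\<lambda>q. q) (T1 c v)) = tensor_map (\<lambda>p. p) (\<lambda>q. T1 q v) (T2 t c)"
    unfolding T1_def[abs_def] T2_def[abs_def] by (rule coassociative)
  show ?thesis using 1[of "T1 c v"] 2[of "T2 t c"] by (simp only: 3)
qed

text \<open>Both sides are \<open>x\<^sub>1 \<otimes> x\<^sub>2 c\<^sub>1 b \<omega>(x\<^sub>3 c\<^sub>2)\<close>, which is covered through \<open>\<Delta>(c) (b \<otimes> 1)\<close>. After
  multiplying the first leg by \<open>t\<close>, both sides come from \<open>(\<iota> \<otimes> \<Delta>)((t \<otimes> 1) \<Delta>(x))\<close> applied to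
  \<open>1 \<otimes> \<Delta>(c) (b \<otimes> 1)\<close>, and the axiom applies.\<close>

lemma coassoc_T3_T1:
  assumes \<omega>: "clinear \<omega>"
  shows "tensor_map (\<lambda>p. p) (\<lambda>q. slice2 \<omega> (T3 q b)) (T1 x c)
    = tensor_lift (\<lambda>b' c'. T1 (slice2 \<omega> (T1 x c')) b') (T3 c b)"
proof (rule leg1_cancel)
  fix t
  have l: "clinear (\<lambda>q. slice2 \<omega> (\<Delta> q \<rhd> z))" "clinear (\<lambda>q. slice2 \<omega> (T1 q v))"
    "clinear (\<lambda>q. slice2 \<omega> (T3 q b))" "clinear (\<lambda>q. slice2 \<omega> (T1 q v) * b)" for z v b
    by (rule clinearI; simp only: lin_simps multiplier_simps slice_add[OF \<omega>] clinear_add[OF comult_linear] clinear_scale[OF comult_linear])+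
  have bl: "bilinear_map (\<lambda>b' c'. T1 (slice2 \<omega> (T1 x c')) b')"
    by (rule bilinear_mapI; simp only: lin_simps slice_add[OF \<omega>])
  have *: "leg1 t \<rhd> tensor_lift (\<lambda>b' c'. T1 (slice2 \<omega> (T1 x c')) b') z
    = tensor_map (\<lambda>p. p) (\<lambda>q. slice2 \<omega> (\<Delta> q \<rhd> z)) (T2 t x)" for z
  proof (induction z rule: tensor_induct)
    case (pair b' c')
    have "tensor_map (\<lambda>p. p) (\<lambda>q. slice2 \<omega> (T1 q c')) w \<lhd> leg2 b'
        = tensor_map (\<lambda>p. p) (\<lambda>q. slice2 \<omega> (T1 q c') * b') w" for w
      by (induction w rule: tensor_induct) (simp_all add: l tensor_map_add clinear_add[OF multiplier_linear(2)])
    then show ?case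
      by (simp add: tensor_lift_pair[OF bl] T_mult coassoc_T2[OF \<omega>] T_acts(1) slice_leg[OF \<omega>])
  next
    case (add x y)
    then show ?case
      by (simp add: clinear_add[OF clinear_tensor_lift[OF bl]] clinear_add[OF multiplier_linear(1)]
          slice_add \<omega> tensor_map_plus l)
  qed
  have "leg1 t \<rhd> tensor_map (\<lambda>p. p) (\<lambda>q. slice2 \<omega> (T3 q b)) z
    = tensor_map (\<lambda>p. p) (\<lambda>q. slice2 \<omega> (T3 q b)) (leg1 t \<rhd> z)" for z
    by (induction z rule: tensor_induct) (simp_all add: l tensor_map_add clinear_add[OF multiplier_linear(1)])
  moreover have "tensor_map (\<lambda>p. p) (\<lambda>q. slice2 \<omega> (T3 q b)) (z \<lhd> leg2 c)
    = tensor_map (\<lambda>p. p) (\<lambda>q. slice2 \<omega> (\<Delta> q \<rhd> T3 c b)) z" for z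
    by (induction z rule: tensor_induct)
      (simp_all add: l tensor_map_add clinear_add[OF multiplier_linear(2)] T_acts(3))
  ultimately show "leg1 t \<rhd> tensor_map (\<lambda>p. p) (\<lambda>q. slice2 \<omega> (T3 q b)) (T1 x c)
    = leg1 t \<rhd> tensor_lift (\<lambda>b' c'. T1 (slice2 \<omega> (T1 x c')) b') (T3 c b)"
    unfolding * by (simp only: T_mult)
qed

text \<open>Coassociativity for \<open>t c\<^sub>1 \<otimes> c\<^sub>2 \<otimes> x c\<^sub>3\<close>. With a further factor \<open>v\<close> in the third leg this is an
  instance of the axiom. To cancel \<open>v\<close>, the third leg must be left free; so a functional \<open>\<rho>\<close> is
  applied to the first two legs, which leaves an element of \<open>A\<close> on each side.\<close>

lemma coassoc_T2_T4:
  assumes \<omega>: "clinear \<omega>"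
  shows "T2 t (slice2 \<omega> (T4 x c)) = tensor_map (\<lambda>p. p) (\<lambda>q. slice2 \<omega> (T4 x q)) (T2 t c)"
proof (rule functional_eqI)
  fix \<rho> :: "('a, 'a) tensor \<Rightarrow> complex" assume \<rho>: "clinear \<rho>"
  have l: "clinear (\<lambda>p. \<rho> (T2 t p))" "clinear (\<lambda>u. \<rho> (p \<otimes> u))" for p
    by (rule clinearI; simp only: lin_simps clinear_add[OF \<rho>] clinear_scale[OF \<rho>])+
  have l4: "clinear (\<lambda>q. slice2 \<kappa> (T4 x q))" if "clinear \<kappa>" for \<kappa> :: "'a \<Rightarrow> complex"
    by (rule clinearI; simp only: lin_simps slice_add[OF that])
  define f where "f = (\<lambda>p q. slice1 (\<lambda>u. \<rho> (p \<otimes> u)) (T4 x q))"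
  have \<kappa>f: "\<kappa> (f p q) = \<rho> (p \<otimes> slice2 \<kappa> (T4 x q))" if "clinear \<kappa>" for \<kappa> p q
    unfolding f_def by (rule functional_slices[OF l(2) that])
  have f: "bilinear_map f"
    by (rule bilinear_mapI; rule functional_eqI)
      (simp_all add: clinear_add clinear_scale \<kappa>f lin_simps slice_add \<rho>)
  have \<kappa>lift: "\<kappa> (tensor_lift f w) = \<rho> (tensor_map (\<lambda>p. p) (\<lambda>q. slice2 \<kappa> (T4 x q)) w)"
    if \<kappa>: "clinear \<kappa>" for \<kappa> w
    by (induction w rule: tensor_induct)
      (simp_all add: f \<kappa>f \<kappa> l4 tensor_map_add clinear_add[OF \<kappa>] clinear_add[OF \<rho>]
        clinear_add[OF clinear_tensor_lift[OF f]])
  have "slice1 (\<lambda>p. \<rho> (T2 t p)) (T4 x c) = tensor_lift f (T2 t c)"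
  proof (rule mult_cancel_right, rule functional_eqI)
    fix v and \<kappa> :: "'a \<Rightarrow> complex" assume \<kappa>: "clinear \<kappa>"
    have k: "clinear (\<lambda>q. \<kappa> (q * v))" "clinear (\<lambda>q. \<kappa> (x * q))"
      by (rule clinearI; simp only: lin_simps clinear_add[OF \<kappa>] clinear_scale[OF \<kappa>])+
    have kT: "slice2 (\<lambda>q. \<kappa> (q * v)) (T4 x q) = slice2 (\<lambda>q. \<kappa> (x * q)) (T1 q v)" for q
      by (simp only: slice_shift(3,4)[OF \<kappa>, symmetric] T_mult)
    have "\<kappa> (slice1 (\<lambda>p. \<rho> (T2 t p)) (T4 x c) * v) = \<rho> (T2 t (slice2 (\<lambda>q. \<kappa> (q * v)) (T4 x c)))"
      by (rule functional_slices[OF l(1) k(1)])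
    also have "\<dots> = \<rho> (tensor_map (\<lambda>p. p) (\<lambda>q. slice2 (\<lambda>q. \<kappa> (q * v)) (T4 x q)) (T2 t c))"
      unfolding kT by (simp only: coassoc_T2[OF k(2)])
    also have "\<dots> = \<kappa> (tensor_lift f (T2 t c) * v)"
      by (rule \<kappa>lift[OF k(1), symmetric])
    finally show "\<kappa> (slice1 (\<lambda>p. \<rho> (T2 t p)) (T4 x c) * v) = \<kappa> (tensor_lift f (T2 t c) * v)" .
  qed
  then show "\<rho> (T2 t (slice2 \<omega> (T4 x c))) = \<rho> (tensor_map (\<lambda>p. p) (\<lambda>q. slice2 \<omega> (T4 x q)) (T2 t c))"
    by (simp only: \<kappa>lift[OF \<omega>, symmetric] functional_slices[OF l(1) \<omega>, symmetric])
qed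

text \<open>Both sides are \<open>c\<^sub>1 r \<otimes> c\<^sub>2 q \<omega>(x c\<^sub>3)\<close>.\<close>

lemma coassoc_T1_T4:
  assumes \<omega>: "clinear \<omega>"
  shows "T1 (slice2 \<omega> (T4 x c)) q \<lhd> leg1 r
    = tensor_lift (\<lambda>c' c''. c' \<otimes> (slice2 \<omega> (T4 x c'') * q)) (T3 c r)"
proof (rule leg1_cancel)
  fix t
  have l4: "clinear (\<lambda>q. slice2 \<omega> (T4 x q))"
    by (rule clinearI; simp only: lin_simps slice_add[OF \<omega>])
  have f: "bilinear_map (\<lambda>c' c''. c' \<otimes> (slice2 \<omega> (T4 x c'') * q))"
    by (rule bilinear_mapI; simp only: lin_simps slice_add[OF \<omega>])
  note add = clinear_add[OF clinear_tensor_lift[OF f]] clinear_add[OF multiplier_linear(1)]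
    clinear_add[OF multiplier_linear(2)] tensor_map_add[OF clinear_id l4]
  have "leg1 t \<rhd> (T1 (slice2 \<omega> (T4 x c)) q \<lhd> leg1 r) = (T2 t (slice2 \<omega> (T4 x c)) \<lhd> leg2 q) \<lhd> leg1 r"
    by (simp only: multiplier_commute T_mult)
  also have "\<dots> = tensor_lift (\<lambda>c' c''. c' \<otimes> (slice2 \<omega> (T4 x c'') * q)) (w \<lhd> leg1 r)"
    if "w = T2 t c" for w
    unfolding coassoc_T2_T4[OF \<omega>] that[symmetric]
    by (induction w rule: tensor_induct) (simp_all add: l4 tensor_lift_pair[OF f] add)
  also have "T2 t c \<lhd> leg1 r = leg1 t \<rhd> T3 c r" by (simp only: T_mult)
  also have "tensor_lift (\<lambda>c' c''. c' \<otimes> (slice2 \<omega> (T4 x c'') * q)) (leg1 t \<rhd> z)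
     = leg1 t \<rhd> tensor_lift (\<lambda>c' c''. c' \<otimes> (slice2 \<omega> (T4 x c'') * q)) z" for z
    by (induction z rule: tensor_induct) (simp_all add: l4 tensor_lift_pair[OF f] add)
  finally show "leg1 t \<rhd> (T1 (slice2 \<omega> (T4 x c)) q \<lhd> leg1 r)
    = leg1 t \<rhd> tensor_lift (\<lambda>c' c''. c' \<otimes> (slice2 \<omega> (T4 x c'') * q)) (T3 c r)" by simp
qed

end

section \<open>Strong left invariance and faithfulness\<close>

locale left_invariant = regular_Hopf_with_antipode \<Delta> \<epsilon> S
  for \<Delta> :: "'a::nondegenerate_algebra \<Rightarrow> ('a, 'a) tensor multiplier" and \<epsilon> S +
  fixes \<phi> :: "'a \<Rightarrow> complex"
  assumes is_left_integral: "left_integral \<Delta> \<phi>"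
begin

lemma phi_linear: "clinear \<phi>"
  using is_left_integral by (simp add: left_integral_def)

lemmas phi_add = clinear_add[OF phi_linear]
lemmas phi_scale = clinear_scale[OF phi_linear, unfolded scaleC_complex_def]

lemma phi_shift: "clinear (\<lambda>q. \<phi> (a * q))" "clinear (\<lambda>q. \<phi> (q * a))"
  by (rule clinearI; simp only: lin_simps phi_add clinear_scale[OF phi_linear])+

lemma left_invariance: "slice2 \<phi> (T3 a b) = \<phi> a *\<^sub>C b"
proof -
  have "mult_slice2 \<phi> (\<Delta> a) \<rhd> b = slice2 \<phi> (T3 a b)"
    unfolding T3_def by (rule mult_slice2(1)[OF phi_linear])
      (auto simp: comult_cover)
  then show ?thesis using is_left_integral by (simp add: left_integral_def)
qed

text \<open>\<open>S(x\<^sub>1) \<phi>(x\<^sub>2 c) = S(x\<^sub>1) x\<^sub>2 c\<^sub>1 \<phi>(x\<^sub>3 c\<^sub>2) = c\<^sub>1 \<phi>(x c\<^sub>2)\<close>: the first step is left invariance for the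
  element \<open>x\<^sub>2 c\<close>, the second the antipode identity. The factor \<open>b\<close> covers the result.\<close>

lemma strong_left_invariance: "S (slice2 \<phi> (T1 x c)) = slice2 \<phi> (T4 x c)"
proof (rule mult_cancel_right)
  fix b
  have l3: "clinear (\<lambda>q. slice2 \<phi> (T3 q b))"
    by (rule clinearI; simp only: lin_simps slice_add[OF phi_linear])
  have m: "bilinear_map (\<lambda>p q. S p * q)"
    by (rule bilinear_mapI; simp only: lin_simps)
  have bl: "bilinear_map (\<lambda>b' c'. T1 (slice2 \<phi> (T1 x c')) b')"
    by (rule bilinear_mapI; simp only: lin_simps slice_add[OF phi_linear])
  have e: "\<epsilon> (slice2 \<phi> (T1 x c')) = \<phi> (x * c')" for c'
    by (simp only: functional_slices[OF counit_linear phi_linear, symmetric] counit_T1)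
  have "S (slice2 \<phi> z) * b = tensor_lift (\<lambda>p q. S p * q) (tensor_map (\<lambda>p. p) (\<lambda>q. slice2 \<phi> (T3 q b)) z)" for z
    by (induction z rule: tensor_induct)
      (simp_all add: l3[unfolded left_invariance] tensor_map_add tensor_lift_pair[OF m] left_invariance slice2 phi_linear slice_add S_scale S_add
        scaleC_mult_left scaleC_mult_right distrib_right clinear_add[OF clinear_tensor_lift[OF m]])
  then have "S (slice2 \<phi> (T1 x c)) * b
      = tensor_lift (\<lambda>p q. S p * q) (tensor_lift (\<lambda>b' c'. T1 (slice2 \<phi> (T1 x c')) b') (T3 c b))"
    by (simp only: coassoc_T3_T1[OF phi_linear])
  also have "\<dots> = tensor_lift (\<lambda>b' c'. \<phi> (x * c') *\<^sub>C b') (T3 c b)"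
    unfolding tensor_lift_comp[OF clinear_tensor_lift[OF m] bl] antipode_T1 e ..
  also have "\<dots> = slice2 (\<lambda>c'. \<phi> (x * c')) (T3 c b)" by (simp add: slice2_def)
  also have "\<dots> = slice2 \<phi> (T4 x c) * b"
    by (simp only: slice_shift(3)[OF phi_linear, symmetric] T_mult slice_leg[OF phi_linear])
  finally show "S (slice2 \<phi> (T1 x c)) * b = slice2 \<phi> (T4 x c) * b" .
qed

text \<open>The slice \<open>x\<^sub>1 \<phi>(x\<^sub>2 c)\<close> visibly vanishes once the first leg is covered. By strong invariance it
  then vanishes in the form \<open>c\<^sub>1 \<phi>(x c\<^sub>2)\<close> as well, where the coproduct sits on \<open>c\<close>. The next lemma
  provides the same for elements annihilated on the other side.\<close>

lemma slice_T1_eq_0: assumes "\<And>x. \<phi> (x * c) = 0" shows "slice2 \<phi> (T1 x c) = 0"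
proof (rule nondegenerate_right)
  fix t
  have "t * slice2 \<phi> (T1 x c) = slice2 (\<lambda>q. \<phi> (q * c)) (T2 t x)"
    by (simp only: slice_leg[OF phi_linear, symmetric] T_mult slice_shift[OF phi_linear])
  also have "\<dots> = 0"
    by (simp add: assms slice2_def) (rule tensor_lift_eq_0, simp_all add: bilinear_map_def clinear_iff)
  finally show "t * slice2 \<phi> (T1 x c) = 0" .
qed

lemma slice_T4_eq_0: assumes "\<And>x. \<phi> (c * x) = 0" shows "slice2 \<phi> (T4 c x) = 0"
proof (rule nondegenerate_left)
  fix t
  have "slice2 \<phi> (T4 c x) * t = slice2 (\<lambda>q. \<phi> (c * q)) (T3 x t)"
    by (simp only: slice_leg[OF phi_linear, symmetric] T_mult[symmetric] slice_shift[OF phi_linear])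
  also have "\<dots> = 0"
    by (simp add: assms slice2_def) (rule tensor_lift_eq_0, simp_all add: bilinear_map_def clinear_iff)
  finally show "slice2 \<phi> (T4 c x) * t = 0" .
qed

lemma S_eq_0_iff [simp]: "S x = 0 \<longleftrightarrow> x = 0"
  by (metis S_eq_iff clinear_0[OF antipode_linear])

lemma phi_mult_nonzero: "\<exists>x y. \<phi> (x * y) \<noteq> 0"
proof (rule ccontr)
  assume "\<not> ?thesis"
  then have 0: "\<phi> (x * y) = 0" for x y by auto
  have "slice2 \<phi> z = 0" for z :: "('a, 'a) tensor"
    by (induction z rule: T1_induct) (simp_all add: slice_T1_eq_0 0 slice_add phi_linear)
  moreover obtain q where q: "\<phi> q \<noteq> 0" using is_left_integral by (auto simp: left_integral_def)
  ultimately have "\<phi> q *\<^sub>C q = 0" using slice2(2)[OF phi_linear, of q q] by simp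
  then have "q = 0" using q by simp
  with q show False by (simp add: clinear_0[OF phi_linear])
qed

text \<open>Let \<open>J\<close> be the left ideal of all \<open>c\<close> with \<open>\<phi>(x c) = 0\<close> for all \<open>x\<close>. Strong invariance gives
  \<open>v c\<^sub>1 \<otimes> c\<^sub>2\<close> and \<open>c\<^sub>1 v \<otimes> c\<^sub>2\<close> in \<open>A \<otimes> J\<close>. Applying \<open>S\<close> to the first leg and multiplying puts
  \<open>\<epsilon>(c) S(t)\<close> in \<open>J\<close> for all \<open>t\<close>. As \<open>S\<close> is surjective and \<open>\<phi>\<close> does not vanish on products,
  \<open>\<epsilon>\<close> is zero on \<open>J\<close>; applying it to the second leg of \<open>v c\<^sub>1 \<otimes> c\<^sub>2\<close> gives \<open>v c = 0\<close>.\<close>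

lemma faithful_left: assumes "\<And>x. \<phi> (x * c) = 0" shows "c = 0"
proof -
  have cov: "\<phi> (x * slice1 \<rho> (T2 v c)) = 0" "\<phi> (x * slice1 \<rho> (T3 c v)) = 0"
    if c: "\<And>x. \<phi> (x * c) = 0" and \<rho>: "clinear \<rho>" for c v x and \<rho> :: "'a \<Rightarrow> complex"
  proof -
    have 4: "slice2 \<phi> (T4 x c) = 0"
      using strong_left_invariance[of x c] slice_T1_eq_0[OF c, of x] by (simp add: clinear_0[OF antipode_linear])
    have "slice2 (\<lambda>q. \<phi> (x * q)) (T2 v c) = v * slice2 \<phi> (T4 x c)"
      by (simp only: slice_leg[OF phi_linear, symmetric] T_mult slice_shift[OF phi_linear, symmetric])
    moreover have "slice2 (\<lambda>q. \<phi> (x * q)) (T3 c v) = slice2 \<phi> (T4 x c) * v"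
      by (simp only: slice_leg[OF phi_linear, symmetric] T_mult slice_shift[OF phi_linear, symmetric])
    ultimately show "\<phi> (x * slice1 \<rho> (T2 v c)) = 0" "\<phi> (x * slice1 \<rho> (T3 c v)) = 0"
      by (simp_all add: functional_slices[OF \<rho> phi_shift(1)] 4 clinear_0[OF \<rho>])
  qed
  have eps: "\<epsilon> c = 0" if c: "\<And>x. \<phi> (x * c) = 0" for c
  proof (rule ccontr)
    assume e: "\<epsilon> c \<noteq> 0"
    have "\<phi> (x * S t) = 0" for x t
    proof -
      have f: "bilinear_map (\<lambda>p q. \<phi> (x * S p * q))"
        by (rule bilinear_mapI; simp only: lin_simps phi_add clinear_scale[OF phi_linear])
      note antipode_T3[of c t]
      moreover have "\<phi> (x * tensor_lift (\<lambda>p q. S p * q) z) = tensor_lift (\<lambda>p q. \<phi> (x * S p * q)) z" for z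
        by (subst tensor_lift_comp[OF phi_shift(1)])
          ((rule bilinear_mapI; simp only: lin_simps), simp add: mult.assoc)
      moreover have "tensor_lift (\<lambda>p q. \<phi> (x * S p * q)) (T3 c t) = 0"
        by (rule tensor_lift_eq_0[OF f]) (rule cov(2)[OF c])
      ultimately have "\<epsilon> c * \<phi> (x * S t) = 0" by (metis phi_scale scaleC_mult_right)
      then show ?thesis using e by simp
    qed
    then show False using phi_mult_nonzero by (metis S_Sinv(1))
  qed
  show ?thesis
  proof (rule nondegenerate_right, rule functional_separates)
    fix v and \<omega> :: "'a \<Rightarrow> complex" assume \<omega>: "clinear \<omega>"
    have "\<omega> (v * c) = \<epsilon> (slice1 \<omega> (T2 v c))"
      by (simp only: counit_T2[symmetric] functional_slices[OF \<omega> counit_linear])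
    also have "\<dots> = 0" by (rule eps, rule cov(1)[OF assms \<omega>])
    finally show "\<omega> (v * c) = 0" .
  qed
qed

text \<open>The argument for \<open>faithful_left\<close> with \<open>J = {c. \<phi>(c x) = 0 for all x}\<close>, a right ideal, and
  the identity \<open>c\<^sub>2 S\<^sup>-\<^sup>1(t c\<^sub>1) = \<epsilon>(c) S\<^sup>-\<^sup>1(t)\<close>.\<close>

lemma faithful_right: assumes "\<And>x. \<phi> (c * x) = 0" shows "c = 0"
proof -
  have cov: "\<phi> (slice1 \<rho> (T2 v c) * x) = 0"
    if c: "\<And>x. \<phi> (c * x) = 0" and \<rho>: "clinear \<rho>" for c v x and \<rho> :: "'a \<Rightarrow> complex"
  proof -
    have 1: "slice2 \<phi> (T1 c x) = 0"
      using strong_left_invariance[of c x] slice_T4_eq_0[OF c, of x] by simp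
    have "slice2 (\<lambda>q. \<phi> (q * x)) (T2 v c) = v * slice2 \<phi> (T1 c x)"
      by (simp only: slice_leg[OF phi_linear, symmetric] T_mult slice_shift[OF phi_linear, symmetric])
    then show "\<phi> (slice1 \<rho> (T2 v c) * x) = 0"
      by (simp add: functional_slices[OF \<rho> phi_shift(2)] 1 clinear_0[OF \<rho>])
  qed
  have eps: "\<epsilon> c = 0" if c: "\<And>x. \<phi> (c * x) = 0" for c
  proof (rule ccontr)
    assume e: "\<epsilon> c \<noteq> 0"
    have "\<phi> (Sinv t * x) = 0" for x t
    proof -
      have f: "bilinear_map (\<lambda>p q. \<phi> (q * (Sinv p * x)))"
        by (rule bilinear_mapI; simp only: lin_simps phi_add clinear_scale[OF phi_linear])
      have l: "clinear (\<lambda>r. \<phi> (Sinv r * x))"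
        by (rule clinearI; simp only: lin_simps phi_add clinear_scale[OF phi_linear])
      have m: "bilinear_map (\<lambda>p q. p * S q)" by (rule bilinear_mapI; simp only: lin_simps)
      have "tensor_lift (\<lambda>p q. \<phi> (q * (Sinv p * x))) (T2 t c) = 0"
        by (rule tensor_lift_eq_0[OF f]) (rule cov[OF c])
      moreover have "\<phi> (Sinv (tensor_lift (\<lambda>p q. p * S q) z) * x) = tensor_lift (\<lambda>p q. \<phi> (q * (Sinv p * x))) z" for z
        by (simp add: tensor_lift_comp[OF l m] Sinv_mult mult.assoc)
      ultimately have "\<phi> (Sinv (\<epsilon> c *\<^sub>C t) * x) = 0" by (metis antipode_T2)
      then have "\<epsilon> c * \<phi> (Sinv t * x) = 0" by (simp add: lin_simps phi_scale)
      then show ?thesis using e by simp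
    qed
    then show False using phi_mult_nonzero by (metis S_Sinv(2))
  qed
  show ?thesis
  proof (rule nondegenerate_right, rule functional_separates)
    fix v and \<omega> :: "'a \<Rightarrow> complex" assume \<omega>: "clinear \<omega>"
    have "\<omega> (v * c) = \<epsilon> (slice1 \<omega> (T2 v c))"
      by (simp only: counit_T2[symmetric] functional_slices[OF \<omega> counit_linear])
    also have "\<dots> = 0" by (rule eps, rule cov[OF assms \<omega>])
    finally show "\<omega> (v * c) = 0" .
  qed
qed

section \<open>The antipode reverses the coproduct\<close>

text \<open>The anti-automorphism \<open>x \<otimes> y \<mapsto> S(y) \<otimes> S(x)\<close> of \<open>A \<otimes> A\<close>. That \<open>S\<close> reverses the coproduct means
  that \<open>Sflip\<close> extends to \<open>\<Delta>(a) \<mapsto> \<Delta>(S(a))\<close>; the covered versions of this statement follow.\<close>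

definition Sflip :: "('a, 'a) tensor \<Rightarrow> ('a, 'a) tensor"
  where "Sflip = tensor_lift (\<lambda>p q. S q \<otimes> S p)"

lemma Sflip_bilinear: "bilinear_map (\<lambda>p q. S q \<otimes> S p)"
  by (rule bilinear_mapI; simp only: lin_simps)

lemma Sflip_pair [simp]: "Sflip (p \<otimes> q) = S q \<otimes> S p"
  by (simp add: Sflip_def Sflip_bilinear)

lemma Sflip_add [simp]: "Sflip (x + y) = Sflip x + Sflip y"
  by (simp add: Sflip_def clinear_add[OF clinear_tensor_lift[OF Sflip_bilinear]])

lemma Sflip_mult: "Sflip (x * y) = Sflip y * Sflip x"
proof -
  have "Sflip ((a \<otimes> b) * y) = Sflip y * Sflip (a \<otimes> b)" for a b
    by (induction y rule: tensor_induct)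
      (simp_all add: times_tensor_pair antipode_mult distrib_left distrib_right)
  then show ?thesis
    by (induction x rule: tensor_induct) (simp_all add: distrib_left distrib_right)
qed

lemma Sflip_legs:
  "Sflip (leg1 a \<rhd> z) = Sflip z \<lhd> leg2 (S a)" "Sflip (leg2 a \<rhd> z) = Sflip z \<lhd> leg1 (S a)"
  "Sflip (z \<lhd> leg1 a) = leg2 (S a) \<rhd> Sflip z" "Sflip (z \<lhd> leg2 a) = leg1 (S a) \<rhd> Sflip z"
  by (induction z rule: tensor_induct; simp add: antipode_mult clinear_add[OF multiplier_linear(1)]
      clinear_add[OF multiplier_linear(2)])+

lemma S_slice2_right:
  "tensor_lift (\<lambda>p q. \<phi> (q * c) *\<^sub>C S p) z = S (slice2 \<phi> (z \<lhd> leg2 c))"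
proof -
  have f: "bilinear_map (\<lambda>p q. \<phi> (q * c) *\<^sub>C S p)"
    by (rule bilinear_mapI; simp only: lin_simps phi_add phi_scale mult.commute)
  show ?thesis
    by (induction z rule: tensor_induct)
      (simp_all add: f slice2 phi_linear S_scale S_add slice_add clinear_add[OF multiplier_linear(2)]
        clinear_add[OF clinear_tensor_lift[OF f]])
qed

text \<open>For \<open>s = x\<^sub>1 \<phi>(x\<^sub>2 c)\<close>, strong left invariance gives \<open>S(s) = c\<^sub>1 \<phi>(x c\<^sub>2)\<close> and hence, applied twice,
  \<open>S(s\<^sub>2) \<otimes> S(s\<^sub>1) = S(x\<^sub>2) \<phi>(x\<^sub>3 c) \<otimes> S(x\<^sub>1) = c\<^sub>1 \<otimes> S(x\<^sub>1) \<phi>(x\<^sub>2 c\<^sub>2) = c\<^sub>1 \<otimes> c\<^sub>2 \<phi>(x c\<^sub>3) = \<Delta>(S(s))\<close>.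
  Such \<open>s\<close> span \<open>A\<close>, because \<open>T1\<close> is surjective. The factors \<open>t\<close> and \<open>r\<close> are covers.\<close>

lemma antipode_comult_T2: "Sflip (T2 t s) = T1 (S s) (S t)"
proof -
  have 1: "Sflip (T2 t (slice2 \<phi> (T1 x c))) = T1 (S (slice2 \<phi> (T1 x c))) (S t)" for x c
  proof (rule leg1_cancel_right)
    fix r
    have l1: "clinear (\<lambda>q. slice2 \<phi> (T1 q c))"
      by (rule clinearI; simp only: lin_simps slice_add[OF phi_linear])
    have bc: "bilinear_map (\<lambda>c' c''. \<phi> (q * c'') *\<^sub>C c')" "bilinear_map (\<lambda>c' c''. \<phi> (q * c'') *\<^sub>C (c' \<otimes> S p))"
      "bilinear_map (\<lambda>p q. \<phi> (q * c) *\<^sub>C S p)" for p q c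
      by (rule bilinear_mapI; simp only: lin_simps phi_add phi_scale mult.commute)+
    have bl: "bilinear_map (\<lambda>c' c''. c' \<otimes> tensor_lift (\<lambda>p q. \<phi> (q * c'') *\<^sub>C S p) w)" for w
      unfolding S_slice2_right
      by (rule bilinear_mapI; simp only: lin_simps leg_linear multiplier_simps slice_add[OF phi_linear])
    have "Sflip (T2 t (slice2 \<phi> (T1 x c))) \<lhd> leg1 r
        = Sflip (tensor_map (\<lambda>p. p) (\<lambda>q. slice2 \<phi> (T1 q c)) (T2 t x)) \<lhd> leg1 r"
      by (simp only: coassoc_T2[OF phi_linear])
    also have "\<dots> = tensor_lift (\<lambda>c' c''. c' \<otimes> tensor_lift (\<lambda>p q. \<phi> (q * c'') *\<^sub>C S p) (T2 t x)) (T3 c r)"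
    proof -
      have "Sflip (tensor_map (\<lambda>p. p) (\<lambda>q. slice2 \<phi> (T1 q c)) w) \<lhd> leg1 r
        = tensor_lift (\<lambda>c' c''. c' \<otimes> tensor_lift (\<lambda>p q. \<phi> (q * c'') *\<^sub>C S p) w) (T3 c r)" for w
      proof (induction w rule: tensor_induct)
        case (pair p q)
        have "slice2 \<phi> (T4 q c) * r = tensor_lift (\<lambda>c' c''. \<phi> (q * c'') *\<^sub>C c') (T3 c r)"
          by (simp only: slice_leg[OF phi_linear, symmetric] T_mult(5)[symmetric] slice_shift(3)[OF phi_linear])
            (simp add: slice2_def)
        moreover have "tensor_lift (\<lambda>c' c''. \<phi> (q * c'') *\<^sub>C c') z \<otimes> S p
            = tensor_lift (\<lambda>c' c''. c' \<otimes> (\<phi> (q * c'') *\<^sub>C S p)) z" for z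
          by (subst tensor_lift_comp[where g = "\<lambda>u. u \<otimes> S p"])
            (auto intro!: clinearI bc simp: lin_simps)
        ultimately show ?case
          by (simp add: l1 bc strong_left_invariance)
      next
        case (add w w')
        have h: "tensor_lift (\<lambda>c' c''. c' \<otimes> tensor_lift (\<lambda>p q. \<phi> (q * c'') *\<^sub>C S p) (w + w')) z
          = tensor_lift (\<lambda>c' c''. c' \<otimes> tensor_lift (\<lambda>p q. \<phi> (q * c'') *\<^sub>C S p) w) z
          + tensor_lift (\<lambda>c' c''. c' \<otimes> tensor_lift (\<lambda>p q. \<phi> (q * c'') *\<^sub>C S p) w') z" for z
        proof (induction z rule: tensor_induct)
          case (pair a b)
          show ?case
            by (simp only: tensor_lift_pair[OF bl], simp only: clinear_add[OF clinear_tensor_lift[OF bc(3)]] lin_simps)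
        next
          case (add a b)
          then show ?case by (simp only: clinear_add[OF clinear_tensor_lift[OF bl]] ac_simps)
        qed
        show ?case
          by (simp only: tensor_map_add[OF clinear_id l1] Sflip_add clinear_add[OF multiplier_linear(2)] h add)
      qed
      then show ?thesis .
    qed
    also have "\<dots> = T1 (S (slice2 \<phi> (T1 x c))) (S t) \<lhd> leg1 r"
      by (simp only: S_slice2_right T_mult(1)[symmetric] slice_leg[OF phi_linear] antipode_mult
          strong_left_invariance coassoc_T1_T4[OF phi_linear])
    finally show "Sflip (T2 t (slice2 \<phi> (T1 x c))) \<lhd> leg1 r = T1 (S (slice2 \<phi> (T1 x c))) (S t) \<lhd> leg1 r" .
  qed
  have 2: "Sflip (T2 t (slice2 \<phi> z)) = T1 (S (slice2 \<phi> z)) (S t)" for z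
    by (induction z rule: T1_induct) (simp_all only: 1 slice_add[OF phi_linear] lin_simps Sflip_add)
  obtain h where "\<phi> h \<noteq> 0" using is_left_integral by (auto simp: left_integral_def)
  then have "slice2 \<phi> (((1 / \<phi> h) *\<^sub>C s) \<otimes> h) = s"
    by (simp add: slice2 phi_linear scaleC_scaleC scaleC_one)
  then show ?thesis using 2 by metis
qed

text \<open>Multiplying by elements of \<open>A \<otimes> A\<close> turns \<open>T2\<close> into the full coproduct and that into \<open>T3\<close>.\<close>

lemma antipode_comult_T3: "Sflip (T3 c x) = T4 (S x) (S c)"
proof (rule mult_cancel_right)
  fix y
  have "Sflip (T3 c x) * Sflip (u \<otimes> v) = T4 (S x) (S c) * Sflip (u \<otimes> v)" for u v
  proof -
    have "Sflip (T3 c x) * Sflip (u \<otimes> v) = Sflip ((u \<otimes> v) * T3 c x)" by (simp only: Sflip_mult)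
    also have "(u \<otimes> v) * T3 c x = ((u \<otimes> v) \<lhd> \<Delta> c) \<lhd> leg1 x"
      by (simp only: multiplier_simps(2)[symmetric] mult_embed_T(3)[symmetric] mult_embed_simps)
    also have "Sflip \<dots> = leg2 (S x) \<rhd> (T1 (S c) (S u) \<lhd> leg1 (S v))"
      by (simp only: T_acts(4) Sflip_legs antipode_comult_T2)
    also have "\<dots> = leg2 (S x) \<rhd> (\<Delta> (S c) \<rhd> Sflip (u \<otimes> v))"
      by (simp only: T_acts(1) Sflip_pair)
    also have "\<dots> = T4 (S x) (S c) * Sflip (u \<otimes> v)"
      by (simp only: multiplier_simps(1)[symmetric] mult_embed_T(4)[symmetric] mult_embed_simps)
    finally show ?thesis .
  qed
  then have "Sflip (T3 c x) * Sflip z = T4 (S x) (S c) * Sflip z" for z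
    by (induction z rule: tensor_induct) (simp_all add: distrib_left)
  moreover have "\<exists>z. y = Sflip z"
  proof (induction y rule: tensor_induct)
    case (pair a b)
    show ?case by (rule exI[of _ "Sinv b \<otimes> Sinv a"]) simp
  next
    case (add x y)
    then show ?case by (metis Sflip_add)
  qed
  ultimately show "Sflip (T3 c x) * y = T4 (S x) (S c) * y" by auto
qed

lemma psi_linear: "clinear (\<lambda>a. \<phi> (S a))"
  by (rule clinearI; simp add: S_add S_scale phi_add clinear_scale[OF phi_linear])

lemma slice_Sflip: "slice2 \<phi> (Sflip z) = S (slice1 (\<lambda>a. \<phi> (S a)) z)"
  by (induction z rule: tensor_induct)
    (simp_all only: Sflip_pair Sflip_add slice1(2)[OF psi_linear] slice2(2)[OF phi_linear] slice_add[OF phi_linear]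
      slice_add[OF psi_linear] lin_simps)

text \<open>The image of strong left invariance under \<open>Sflip\<close>: \<open>S(x\<^sub>2) \<psi>(c x\<^sub>1) = c\<^sub>2 \<psi>(c\<^sub>1 x)\<close> for
  \<open>\<psi> = \<phi> \<circ> S\<close>, up to one more application of \<open>S\<close>.\<close>

lemma strong_right_invariance: "S (slice1 (\<lambda>a. \<phi> (S a)) (T2 c x)) = slice1 (\<lambda>a. \<phi> (S a)) (T3 c x)"
proof -
  have "S (S (slice1 (\<lambda>a. \<phi> (S a)) (T2 c x))) = S (slice1 (\<lambda>a. \<phi> (S a)) (T3 c x))"
    by (simp only: slice_Sflip[symmetric] antipode_comult_T2 antipode_comult_T3 strong_left_invariance)
  then show ?thesis by simp
qed

section \<open>Functionals in the dual\<close>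

lemma convolve_bilinear: "bilinear_map (\<lambda>p q. \<phi> (S (S q * a)) *\<^sub>C p)"
  by (rule bilinear_mapI; simp only: lin_simps phi_add phi_scale mult.commute)

text \<open>\<open>\<psi>(S(x)a\<^sub>1) a\<^sub>2 = x\<^sub>1 \<psi>(S(x\<^sub>2)a)\<close> is strong right invariance with \<open>S(x)\<close>
  in place of \<open>c\<close>. It evaluates a convolution whose second factor is \<open>\<psi>(S(\<sqdot>) a)\<close>. Covers are needed
  on the right for the left integral of the dual, and on the left for the modular element.\<close>

lemma psi_slice_antipode_right:
  "slice1 (\<lambda>a. \<phi> (S a)) (T2 (S x) a) * d = tensor_lift (\<lambda>p q. \<phi> (S (S q * a)) *\<^sub>C p) (T3 x d)"
proof -
  have "S (slice1 (\<lambda>a. \<phi> (S a)) (T2 (S x) a) * d) = slice1 (\<lambda>a. \<phi> (S a)) (leg2 (S d) \<rhd> T3 (S x) a)"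
    by (simp only: antipode_mult strong_right_invariance slice_leg[OF psi_linear])
  also have "\<dots> = slice1 (\<lambda>a. \<phi> (S a)) (Sflip (T3 x d) \<lhd> leg1 a)"
    by (simp only: T_mult antipode_comult_T3)
  also have "slice1 (\<lambda>a. \<phi> (S a)) (Sflip z \<lhd> leg1 a) = S (tensor_lift (\<lambda>p q. \<phi> (S (S q * a)) *\<^sub>C p) z)" for z
    by (induction z rule: tensor_induct)
      (simp_all add: lin_simps slice1 slice_add psi_linear convolve_bilinear
        clinear_add[OF clinear_tensor_lift[OF convolve_bilinear]])
  finally show ?thesis by simp
qed

lemma psi_slice_antipode_left:
  "w * slice1 (\<lambda>a. \<phi> (S a)) (T2 (S x) a) = tensor_lift (\<lambda>p q. \<phi> (S (S q * a)) *\<^sub>C p) (T2 w x)"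
proof (rule mult_cancel_right)
  fix d :: 'a
  note add = clinear_add[OF clinear_tensor_lift[OF convolve_bilinear]] clinear_add[OF multiplier_linear(1)]
    clinear_add[OF multiplier_linear(2)]
  have "w * tensor_lift (\<lambda>p q. \<phi> (S (S q * a)) *\<^sub>C p) z = tensor_lift (\<lambda>p q. \<phi> (S (S q * a)) *\<^sub>C p) (leg1 w \<rhd> z)" for z
    by (induction z rule: tensor_induct) (simp_all add: add convolve_bilinear scaleC_mult_right distrib_left)
  moreover have "tensor_lift (\<lambda>p q. \<phi> (S (S q * a)) *\<^sub>C p) z * d = tensor_lift (\<lambda>p q. \<phi> (S (S q * a)) *\<^sub>C p) (z \<lhd> leg1 d)" for z
    by (induction z rule: tensor_induct) (simp_all add: add convolve_bilinear scaleC_mult_left distrib_right)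
  ultimately show "w * slice1 (\<lambda>a. \<phi> (S a)) (T2 (S x) a) * d = tensor_lift (\<lambda>p q. \<phi> (S (S q * a)) *\<^sub>C p) (T2 w x) * d"
    by (simp only: mult.assoc psi_slice_antipode_right T_mult)
qed

text \<open>Both sides are \<open>\<psi>(d x\<^sub>1) \<phi>(x\<^sub>2 c)\<close>, evaluated by strong left invariance and by strong right
  invariance. The elements multiplied with \<open>x\<close> are slices of \<open>T3 c (S d)\<close> and \<open>T4 (S c) d\<close>; by
  surjectivity they range over all of \<open>A\<close> on either side, so that \<open>\<phi>(\<sqdot> A) = \<psi>(A \<sqdot>)\<close>.\<close>

lemma phi_right_eq_psi_left:
  "\<phi> (x * slice1 \<phi> (T3 c (S d))) = \<phi> (S (slice2 (\<lambda>q. \<phi> (Sinv q)) (T4 (S c) d) * x))"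
proof -
  have Y: "clinear (\<lambda>q. \<phi> (Sinv q))"
    by (rule clinearI; simp only: lin_simps phi_add clinear_scale[OF phi_linear])
  let ?\<psi> = "\<lambda>a. \<phi> (S a)"
  have "\<phi> (x * slice1 \<phi> (T3 c (S d))) = \<phi> (slice2 \<phi> (T4 x c) * S d)"
    by (simp only: functional_tensor_mult[OF phi_linear phi_linear] T_mult)
  also have "\<dots> = ?\<psi> (d * slice2 \<phi> (T1 x c))"
    by (simp only: antipode_mult strong_left_invariance)
  also have "\<dots> = \<phi> (slice1 ?\<psi> (T2 d x) * c)"
    by (simp only: functional_tensor_mult[OF psi_linear phi_linear] T_mult functional_slices[OF psi_linear phi_linear])
  also have "\<dots> = \<phi> (Sinv (S c * slice1 ?\<psi> (T3 d x)))"
    by (simp add: Sinv_mult strong_right_invariance[symmetric])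
  also have "\<dots> = ?\<psi> (slice2 (\<lambda>q. \<phi> (Sinv q)) (T4 (S c) d) * x)"
    by (simp only: functional_tensor_mult[OF psi_linear Y] T_mult)
  finally show ?thesis .
qed

lemma phi_normalized: obtains h where "\<phi> h = 1"
proof -
  obtain a where a: "\<phi> a \<noteq> 0" using is_left_integral by (auto simp: left_integral_def)
  show thesis by (rule that[of "(1 / \<phi> a) *\<^sub>C a"]) (simp add: phi_scale a)
qed

lemma dual_right_to_left: "\<exists>v. \<forall>x. \<phi> (x * u) = \<phi> (S (v * x))"
proof -
  obtain h where h: "\<phi> h = 1" by (rule phi_normalized)
  have "\<exists>v. \<forall>x. \<phi> (x * slice1 \<phi> z) = \<phi> (S (v * x))" for z :: "('a, 'a) tensor"
  proof (induction z rule: T3_induct)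
    case (pair a b)
    then show ?case using phi_right_eq_psi_left[of _ a "Sinv b"] by auto
  next
    case (add y z)
    then obtain v w where "\<And>x. \<phi> (x * slice1 \<phi> y) = \<phi> (S (v * x))" "\<And>x. \<phi> (x * slice1 \<phi> z) = \<phi> (S (w * x))" by blast
    then show ?case by (intro exI[of _ "v + w"]) (simp add: slice_add phi_linear lin_simps phi_add)
  qed
  from this[of "h \<otimes> u"] show ?thesis by (simp add: slice1 phi_linear h scaleC_one)
qed

lemma dual_left_to_right: "\<exists>u. \<forall>x. \<phi> (x * u) = \<phi> (S (v * x))"
proof -
  have Y: "clinear (\<lambda>q. \<phi> (Sinv q))"
    by (rule clinearI; simp only: lin_simps phi_add clinear_scale[OF phi_linear])
  obtain h where h: "\<phi> h = 1" by (rule phi_normalized)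
  have "\<exists>u. \<forall>x. \<phi> (x * u) = \<phi> (S (slice2 (\<lambda>q. \<phi> (Sinv q)) z * x))" for z :: "('a, 'a) tensor"
  proof (induction z rule: T4_induct)
    case (pair a b)
    then show ?case using phi_right_eq_psi_left[of _ "Sinv a" b] by auto
  next
    case (add y z)
    then obtain u w where "\<And>x. \<phi> (x * u) = \<phi> (S (slice2 (\<lambda>q. \<phi> (Sinv q)) y * x))" "\<And>x. \<phi> (x * w) = \<phi> (S (slice2 (\<lambda>q. \<phi> (Sinv q)) z * x))" by blast
    then show ?case by (intro exI[of _ "u + w"]) (simp add: slice_add Y lin_simps phi_add)
  qed
  from this[of "v \<otimes> S h"] show ?thesis by (simp add: slice2 Y h scaleC_one)
qed

end

section \<open>The modular element\<close>

locale modular_left_invariant = left_invariant +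
  fixes \<delta> \<delta>' :: "'a multiplier"
  assumes \<delta>_inverse: "\<delta> * \<delta>' = 1" "\<delta>' * \<delta> = 1"
    and phi_S: "\<phi> (S a) = \<phi> (a \<lhd> \<delta>)"
begin

lemma \<delta>_cancel [simp]: "\<delta> \<rhd> (\<delta>' \<rhd> a) = a" "\<delta>' \<rhd> (\<delta> \<rhd> a) = a" "a \<lhd> \<delta> \<lhd> \<delta>' = a" "a \<lhd> \<delta>' \<lhd> \<delta> = a"
  using \<delta>_inverse by (metis multiplier_simps(1-4))+

lemma leg_right: "leg2 (d \<lhd> m) = leg2 d * mult_tensor 1 m"
  by (simp add: mult_tensor_mult mult_embed_multiplier)

lemma slice_modular:
  "slice2 \<phi> (z \<lhd> mult_tensor 1 \<delta>) = slice2 (\<lambda>a. \<phi> (S a)) z"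
  "slice1 \<phi> (z' \<lhd> mult_tensor \<delta> \<delta>) = slice1 (\<lambda>a. \<phi> (S a)) z' \<lhd> \<delta>"
proof -
  have l: "clinear (\<lambda>a. \<phi> (a \<lhd> \<delta>))"
    by (rule clinearI; simp only: lin_simps phi_add clinear_scale[OF phi_linear])
  show "slice2 \<phi> (z \<lhd> mult_tensor 1 \<delta>) = slice2 (\<lambda>a. \<phi> (S a)) z" unfolding phi_S
    by (induction z rule: tensor_induct) (simp_all add: slice2 phi_linear l slice_add clinear_add[OF multiplier_linear(2)])
  show "slice1 \<phi> (z' \<lhd> mult_tensor \<delta> \<delta>) = slice1 (\<lambda>a. \<phi> (S a)) z' \<lhd> \<delta>" unfolding phi_S
    by (induction z' rule: tensor_induct) (simp_all add: slice1 phi_linear l slice_add clinear_add[OF multiplier_linear(2)]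
      clinear_scale[OF multiplier_linear(2)])
qed

lemma slice1_phi_separates: assumes "\<And>x. slice1 \<phi> (leg1 x \<rhd> z) = 0" shows "z = 0"
proof (rule slice2_separates, rule faithful_left)
  fix \<omega> :: "'b \<Rightarrow> complex" and x assume \<omega>: "clinear \<omega>"
  have "\<phi> (x * slice2 \<omega> z) = \<omega> (slice1 \<phi> (leg1 x \<rhd> z))"
    by (simp only: functional_slices[OF phi_linear \<omega>] slice_leg[OF \<omega>])
  then show "\<phi> (x * slice2 \<omega> z) = 0" using assms by (simp add: clinear_0[OF \<omega>])
qed

lemma faithful_eqI: assumes "\<And>w. \<phi> (w * x) = \<phi> (w * y)" shows "x = y"
proof -
  have "x - y = 0"
  proof (rule faithful_left)
    fix w
    have "\<phi> (w * x) = \<phi> (w * (x - y) + w * y)" by (simp add: algebra_simps)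
    then show "\<phi> (w * (x - y)) = 0" using assms[of w] by (simp add: phi_add)
  qed
  then show ?thesis by simp
qed

text \<open>Apply \<open>\<phi>(x \<sqdot>) \<otimes> \<phi>(w \<sqdot>)\<close> to both sides, with \<open>x = S(x')\<close>. Strong left invariance for \<open>d \<delta>\<close>,
  with \<open>\<phi>(w\<^sub>2 d \<delta>) = \<psi>(w\<^sub>2 d)\<close>, turns \<open>\<phi>(x (d \<delta>)\<^sub>1) \<phi>(w (d \<delta>)\<^sub>2)\<close> into \<open>\<psi>(w\<^sub>1 x') \<psi>(w\<^sub>2 d)\<close>. Strong right
  invariance, used twice, brings this to \<open>\<psi>(S(x') d\<^sub>1) \<psi>(w d\<^sub>2)\<close>, that is, to
  \<open>\<phi>(x d\<^sub>1 \<delta>) \<phi>(w d\<^sub>2 \<delta>)\<close>.\<close>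

lemma modular_group_like: "T2 r (d \<lhd> \<delta>) = T2 r d \<lhd> mult_tensor \<delta> \<delta>"
proof -
  let ?\<psi> = "\<lambda>a. \<phi> (S a)"
  have *: "slice1 \<phi> (T2 x (d \<lhd> \<delta>)) = slice1 \<phi> (T2 x d \<lhd> mult_tensor \<delta> \<delta>)" for x
  proof (rule faithful_eqI)
    fix w
    define x' where "x' = Sinv x"
    have x: "x = S x'" by (simp add: x'_def)
    have f: "bilinear_map (\<lambda>p q. \<phi> (S (S q * d)) *\<^sub>C p)" by (rule convolve_bilinear)
    have "T1 w (d \<lhd> \<delta>) = T1 w d \<lhd> mult_tensor 1 \<delta>"
      by (simp only: T1_def leg_right mult.assoc[symmetric] element_mult(2) comult_cover)
    then have T1: "slice2 \<phi> (T1 w (d \<lhd> \<delta>)) = slice2 ?\<psi> (T1 w d)"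
      by (simp only: slice_modular)
    have "\<phi> (w * slice1 \<phi> (T2 x (d \<lhd> \<delta>))) = \<phi> (x * slice2 \<phi> (T4 w (d \<lhd> \<delta>)))"
      by (simp only: functional_tensor_mult[OF phi_linear phi_linear] functional_slices[OF phi_linear phi_linear] T_mult)
    also have "\<dots> = ?\<psi> (slice2 ?\<psi> (T1 w d) * x')"
      by (simp only: strong_left_invariance[symmetric] T1 antipode_mult x)
    also have "\<dots> = ?\<psi> (slice1 ?\<psi> (T3 w x') * d)"
      by (simp only: functional_tensor_mult[OF psi_linear psi_linear] functional_slices[OF psi_linear psi_linear]
          T_acts(1)[symmetric] T_acts(2)[symmetric])
    also have "\<dots> = ?\<psi> (S (slice1 ?\<psi> (T2 w x')) * d)" by (simp only: strong_right_invariance)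
    also have "\<dots> = ?\<psi> (tensor_lift (\<lambda>p q. \<phi> (S (S q * d)) *\<^sub>C p) z)" if "z = T2 w x'" for z
      unfolding that[symmetric]
      by (induction z rule: tensor_induct)
        (simp_all add: lin_simps slice1 slice_add psi_linear f phi_add phi_scale clinear_add[OF clinear_tensor_lift[OF f]])
    also have "?\<psi> (tensor_lift (\<lambda>p q. \<phi> (S (S q * d)) *\<^sub>C p) (T2 w x')) = ?\<psi> (w * slice1 ?\<psi> (T2 x d))"
      by (simp only: psi_slice_antipode_left x)
    also have "\<dots> = \<phi> (w * slice1 \<phi> (T2 x d \<lhd> mult_tensor \<delta> \<delta>))"
      by (simp only: slice_modular phi_S multiplier_assoc)
    finally show "\<phi> (w * slice1 \<phi> (T2 x (d \<lhd> \<delta>))) = \<phi> (w * slice1 \<phi> (T2 x d \<lhd> mult_tensor \<delta> \<delta>))" by simp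
  qed
  have "T2 r (d \<lhd> \<delta>) - T2 r d \<lhd> mult_tensor \<delta> \<delta> = 0"
  proof (rule slice1_phi_separates)
    fix x
    let ?l = "leg1 x \<rhd> T2 r (d \<lhd> \<delta>)" and ?r = "leg1 x \<rhd> (T2 r d \<lhd> mult_tensor \<delta> \<delta>)"
    have "slice1 \<phi> ?l = slice1 \<phi> ?r"
      by (simp only: multiplier_commute T_mult *)
    moreover have "?l = leg1 x \<rhd> (T2 r (d \<lhd> \<delta>) - T2 r d \<lhd> mult_tensor \<delta> \<delta>) + ?r"
      by (simp add: clinear_add[OF multiplier_linear(1), symmetric])
    ultimately show "slice1 \<phi> (leg1 x \<rhd> (T2 r (d \<lhd> \<delta>) - T2 r d \<lhd> mult_tensor \<delta> \<delta>)) = 0"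
      by (metis add_cancel_left_left slice_add(1) phi_linear)
  qed
  then show ?thesis by simp
qed

text \<open>As \<open>\<epsilon>\<close> is a character, \<open>\<epsilon>(\<sqdot> \<delta>)\<close> is a multiple of \<open>\<epsilon>\<close>. Applying \<open>\<iota> \<otimes> \<epsilon>\<close> to the group-like
  identity shows that the factor is 1.\<close>

lemma counit_modular: "\<epsilon> (d \<lhd> \<delta>) = \<epsilon> d"
proof -
  obtain a b :: 'a where ab: "a * b \<noteq> 0"
    using phi_mult_nonzero by (metis clinear_0[OF phi_linear])
  have "\<exists>p. \<epsilon> p \<noteq> 0"
  proof (rule ccontr)
    assume "\<not> ?thesis"
    then have 0: "\<epsilon> p = 0" for p by simp
    have "slice2 \<epsilon> z = 0" for z :: "('a, 'a) tensor"
      by (induction z rule: tensor_induct) (simp_all only: slice2(2)[OF counit_linear] slice_add[OF counit_linear], simp_all add: 0)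
    then show False using ab counit_T2[of a b] by simp
  qed
  then obtain p where p: "\<epsilon> p \<noteq> 0" by blast
  define \<kappa> where "\<kappa> = \<epsilon> (\<delta> \<rhd> p) / \<epsilon> p"
  have k: "\<epsilon> (q \<lhd> \<delta>) = \<kappa> * \<epsilon> q" for q
  proof -
    have "\<epsilon> (q \<lhd> \<delta>) * \<epsilon> p = \<epsilon> q * \<epsilon> (\<delta> \<rhd> p)"
      by (simp only: counit_mult[symmetric] multiplier_assoc(3))
    then show ?thesis using p by (simp add: \<kappa>_def field_simps)
  qed
  have s: "slice2 \<epsilon> (z \<lhd> mult_tensor \<delta> \<delta>) = \<kappa> *\<^sub>C (slice2 \<epsilon> z \<lhd> \<delta>)" for z :: "('a, 'a) tensor"
    by (induction z rule: tensor_induct)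
      (simp_all add: slice2 counit_linear k lin_simps slice_add)
  have "a * (b \<lhd> \<delta>) = \<kappa> *\<^sub>C ((a * b) \<lhd> \<delta>)"
    using counit_T2[of a "b \<lhd> \<delta>"] by (simp only: modular_group_like s counit_T2)
  then have "a * b \<lhd> \<delta> \<lhd> \<delta>' = (\<kappa> *\<^sub>C ((a * b) \<lhd> \<delta>)) \<lhd> \<delta>'" by (simp only: multiplier_assoc(2))
  then have "a * b = \<kappa> *\<^sub>C (a * b)" by (simp only: clinear_scale[OF multiplier_linear(2)] \<delta>_cancel)
  then have "(\<kappa> - 1) *\<^sub>C (a * b) = 0" by (simp add: cvec.scale_left_diff_distrib)
  then have "\<kappa> = 1" using ab by simp
  then show ?thesis using k by simp
qed

text \<open>\<open>S(\<delta>) = \<delta>\<^sup>-\<^sup>1\<close>: by the antipode identity, \<open>r d\<^sub>1 \<delta> S(d\<^sub>2 \<delta>) = \<epsilon>(d \<delta>) r = \<epsilon>(d) r = r d\<^sub>1 S(d\<^sub>2)\<close>, and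
  \<open>r d\<^sub>1 \<otimes> d\<^sub>2\<close> spans \<open>A \<otimes> A\<close>.\<close>

lemma antipode_modular: "S (q \<lhd> \<delta>) = \<delta>' \<rhd> S q"
proof -
  have b: "bilinear_map (\<lambda>p q. p * S q)" "bilinear_map (\<lambda>p q. p * (\<delta> \<rhd> S (q \<lhd> \<delta>)))"
    by (rule bilinear_mapI; simp only: lin_simps)+
  note add = clinear_add[OF clinear_tensor_lift[OF b(1)]] clinear_add[OF clinear_tensor_lift[OF b(2)]]
    clinear_add[OF multiplier_linear(2)]
  have e: "tensor_lift (\<lambda>p q. p * S q) (z \<lhd> mult_tensor \<delta> \<delta>) = tensor_lift (\<lambda>p q. p * (\<delta> \<rhd> S (q \<lhd> \<delta>))) z" for z
    by (induction z rule: tensor_induct) (simp_all only: mult_tensor_pair tensor_lift_pair[OF b(1)] tensor_lift_pair[OF b(2)] add multiplier_assoc(3)[symmetric])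
  have e2: "tensor_lift (\<lambda>p q. p * (\<delta> \<rhd> S (q \<lhd> \<delta>))) (T2 r d) = tensor_lift (\<lambda>p q. p * S q) (T2 r d)" for r d
    by (simp only: e[symmetric] modular_group_like[symmetric] antipode_T2 counit_modular)
  have "tensor_lift (\<lambda>p q. p * (\<delta> \<rhd> S (q \<lhd> \<delta>))) z = tensor_lift (\<lambda>p q. p * S q) z" for z
    by (induction z rule: T2_induct) (simp_all only: e2 add)
  from this[of "_ \<otimes> q"] have "p * (\<delta> \<rhd> S (q \<lhd> \<delta>)) = p * S q" for p
    by (simp only: tensor_lift_pair[OF b(1)] tensor_lift_pair[OF b(2)])
  then have "\<delta> \<rhd> S (q \<lhd> \<delta>) = S q" by (rule mult_cancel_left)
  then show ?thesis by (metis \<delta>_cancel(2))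
qed

text \<open>\<open>S\<^sup>-\<^sup>1(\<delta>) = \<delta>\<^sup>-\<^sup>1\<close> follows from \<open>S(\<delta>\<^sup>-\<^sup>1) = \<delta>\<close>. Since \<open>S\<close> is not defined on multipliers, the latter
  is derived by testing against a factor \<open>S(S\<^sup>-\<^sup>1(y))\<close>.\<close>

lemma Sinv_modular: "Sinv (t \<lhd> \<delta>) = \<delta>' \<rhd> Sinv t"
proof -
  have "S (\<delta>' \<rhd> q) = S q \<lhd> \<delta>" for q
  proof (rule mult_cancel_right)
    fix y
    have "S (\<delta>' \<rhd> q) * S (Sinv y) = S ((Sinv y \<lhd> \<delta>') * q)"
      by (simp only: antipode_mult[symmetric] multiplier_assoc)
    also have "\<dots> = S q * (\<delta> \<rhd> S (Sinv y))"
      using antipode_modular[of "Sinv y \<lhd> \<delta>'"] by (simp only: antipode_mult \<delta>_cancel)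
    finally show "S (\<delta>' \<rhd> q) * y = (S q \<lhd> \<delta>) * y" by (simp add: multiplier_assoc)
  qed
  from this[of "Sinv t"] show ?thesis by (metis S_Sinv)
qed

section \<open>Integrals and modular automorphisms of the dual\<close>

text \<open>Faithfulness makes the inverses in the definitions of the dual product and of the dual
  integrals genuine.\<close>

lemma inj_dual_element: "inj (dual_element \<phi>)"
proof (rule injI)
  fix c c' assume "dual_element \<phi> c = dual_element \<phi> c'"
  then show "c = c'" by (intro faithful_eqI) (simp add: dual_element_def fun_eq_iff)
qed

lemma dual_mult_eq:
  "dual_mult \<Delta> \<phi> (dual_element \<phi> d) (dual_element \<phi> c) = (\<lambda>x. \<phi> (slice2 \<phi> (T1 x c) * d))"
proof
  fix x
  have b: "bilinear_map (\<lambda>x y. \<phi> x * \<phi> y)"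
    by (rule bilinear_mapI; simp only: lin_simps phi_add phi_scale scaleC_complex_def mult_ac)
  have "tensor_lift (\<lambda>x y. \<phi> x * \<phi> y) z = \<phi> (slice2 \<phi> z)" for z
    by (induction z rule: tensor_induct)
      (simp_all add: b slice2 phi_linear phi_scale phi_add slice_add clinear_add[OF clinear_tensor_lift[OF b]])
  then show "dual_mult \<Delta> \<phi> (dual_element \<phi> d) (dual_element \<phi> c) x = \<phi> (slice2 \<phi> (T1 x c) * d)"
    unfolding dual_mult_def dual_pairing2_def inv_f_f[OF inj_dual_element] T_acts(1)
    by (simp only: slice_leg[OF phi_linear])
qed

text \<open>\<open>\<phi>(x\<^sub>1 d) \<phi>(x\<^sub>2 c) = \<phi>(x c\<^sub>2) \<phi>(S\<^sup>-\<^sup>1(c\<^sub>1) d)\<close>, so that the product is \<open>\<phi>(\<sqdot> c')\<close> with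
  \<open>c' = \<phi>(S\<^sup>-\<^sup>1(c\<^sub>1) d) c\<^sub>2\<close>. Here \<open>S\<^sup>-\<^sup>1(c\<^sub>1) d = S\<^sup>-\<^sup>1(S(d) c\<^sub>1)\<close> provides the cover of \<open>\<Delta>(c)\<close>.\<close>

lemma dual_right_integral_mult:
  "dual_right_integral \<phi> \<epsilon> (dual_mult \<Delta> \<phi> (dual_element \<phi> d) (dual_element \<phi> c)) = \<phi> (Sinv c * d)"
proof -
  let ?\<rho> = "\<lambda>q. \<phi> (Sinv q)"
  have Y: "clinear ?\<rho>"
    by (rule clinearI; simp only: lin_simps phi_add clinear_scale[OF phi_linear])
  have "\<phi> (slice2 \<phi> (T1 x c) * d) = \<phi> (x * slice1 ?\<rho> (T2 (S d) c))" for x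
  proof -
    have "\<phi> (slice2 \<phi> (T1 x c) * d) = ?\<rho> (S d * slice2 \<phi> (T4 x c))"
      by (simp add: strong_left_invariance[symmetric] Sinv_mult)
    also have "\<dots> = \<phi> (x * slice1 ?\<rho> (T2 (S d) c))"
      by (simp only: functional_tensor_mult[OF Y phi_linear] T_mult)
    finally show ?thesis .
  qed
  then have "dual_mult \<Delta> \<phi> (dual_element \<phi> d) (dual_element \<phi> c) = dual_element \<phi> (slice1 ?\<rho> (T2 (S d) c))"
    unfolding dual_mult_eq by (simp only: dual_element_def)
  then have "dual_right_integral \<phi> \<epsilon> (dual_mult \<Delta> \<phi> (dual_element \<phi> d) (dual_element \<phi> c))
      = \<epsilon> (slice1 ?\<rho> (T2 (S d) c))"
    by (simp only: dual_right_integral_def inv_f_f[OF inj_dual_element])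
  then show ?thesis by (simp add: functional_slices[OF Y counit_linear] counit_T2 Sinv_mult)
qed

lemma inj_dual_psi: "inj (\<lambda>a x. \<phi> (S (S x * a)))"
proof (rule injI)
  fix a a' assume e: "(\<lambda>x. \<phi> (S (S x * a))) = (\<lambda>x. \<phi> (S (S x * a')))"
  have "S a - S a' = 0"
  proof (rule faithful_right)
    fix x
    have "\<phi> (S a * x) = \<phi> (S a' * x)" using fun_cong[OF e, of "Sinv (Sinv x)"] by (simp add: antipode_mult)
    moreover have "\<phi> (S a * x) = \<phi> ((S a - S a') * x + S a' * x)" by (simp add: algebra_simps)
    ultimately show "\<phi> ((S a - S a') * x) = 0" by (simp add: phi_add)
  qed
  then show "a = a'" by simp
qed

text \<open>With \<open>\<phi>(\<sqdot> c) = \<psi>(S(\<sqdot>) a)\<close> the product is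
  \<open>\<phi>(x\<^sub>1 d) \<psi>(S(x\<^sub>2) a) = \<psi>(S(x) a\<^sub>1) \<phi>(a\<^sub>2 d)\<close>, hence of the form \<open>\<psi>(S(\<sqdot>) a'')\<close> with
  \<open>a'' = a\<^sub>1 \<phi>(a\<^sub>2 d)\<close>.\<close>

lemma dual_left_integral_mult:
  assumes c: "\<And>x. \<phi> (x * c) = \<phi> (S (S x * a))"
  shows "dual_left_integral (\<phi> \<circ> S) S \<epsilon> (dual_mult \<Delta> \<phi> (dual_element \<phi> d) (dual_element \<phi> c)) = \<phi> (a * d)"
proof -
  let ?\<psi> = "\<lambda>a. \<phi> (S a)"
  note add = clinear_add[OF clinear_tensor_lift[OF convolve_bilinear]]
  have "\<phi> (slice2 \<phi> (T1 x c) * d) = ?\<psi> (S x * slice2 \<phi> (T1 a d))" for x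
  proof -
    have "\<phi> (slice2 \<phi> (T1 x c) * d) = \<phi> (slice1 \<phi> (T3 x d) * c)"
      by (simp only: functional_tensor_mult[OF phi_linear phi_linear] T_acts(1)[symmetric] T_acts(2)[symmetric])
    also have "\<phi> (slice1 \<phi> z * c) = \<phi> (tensor_lift (\<lambda>p q. \<phi> (S (S q * a)) *\<^sub>C p) z)" for z
      by (induction z rule: tensor_induct)
        (simp_all add: slice1 phi_linear convolve_bilinear lin_simps phi_scale c slice_add phi_add add)
    also have "\<phi> (tensor_lift (\<lambda>p q. \<phi> (S (S q * a)) *\<^sub>C p) (T3 x d)) = \<phi> (slice1 ?\<psi> (T2 (S x) a) * d)"
      by (simp only: psi_slice_antipode_right)
    also have "\<dots> = ?\<psi> (S x * slice2 \<phi> (T1 a d))"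
      by (simp only: functional_tensor_mult[OF psi_linear phi_linear] T_mult)
    finally show ?thesis .
  qed
  then have "dual_mult \<Delta> \<phi> (dual_element \<phi> d) (dual_element \<phi> c) = (\<lambda>a x. \<phi> (S (S x * a))) (slice2 \<phi> (T1 a d))"
    by (simp only: dual_mult_eq)
  then have "dual_left_integral (\<phi> \<circ> S) S \<epsilon> (dual_mult \<Delta> \<phi> (dual_element \<phi> d) (dual_element \<phi> c))
      = \<epsilon> (slice2 \<phi> (T1 a d))"
    unfolding dual_left_integral_def o_apply by (simp only: inv_f_f[OF inj_dual_psi])
  then show ?thesis by (simp add: functional_slices[OF counit_linear phi_linear, symmetric] counit_T1)
qed

text \<open>\<open>\<psi>(S(x) a) = \<phi>(S(x) a \<delta>) = \<psi>(v x)\<close> for \<open>S(v) = a \<delta>\<close>, and \<open>\<psi>(A \<sqdot>) = \<phi>(\<sqdot> A)\<close>. So the functionals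
  \<open>\<psi>(S(\<sqdot>) a)\<close> are exactly the elements of the dual.\<close>

lemma dual_as_psi: "\<exists>a. \<forall>x. \<phi> (x * c) = \<phi> (S (S x * a))"
proof -
  obtain v where "\<And>x. \<phi> (x * c) = \<phi> (S (v * x))" using dual_right_to_left[of c] by blast
  then have "\<phi> (x * c) = \<phi> (S (S x * (S v \<lhd> \<delta>')))" for x
    by (simp only: phi_S[of "S x * (S v \<lhd> \<delta>')"] multiplier_assoc(2) \<delta>_cancel antipode_mult[of v])
  then show ?thesis by blast
qed

lemma psi_in_dual: "\<exists>c. \<forall>x. \<phi> (x * c) = \<phi> (S (S x * a))"
proof -
  obtain c where "\<And>x. \<phi> (x * c) = \<phi> (S (Sinv (a \<lhd> \<delta>) * x))" using dual_left_to_right[of "Sinv (a \<lhd> \<delta>)"] by blast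
  then have "\<phi> (x * c) = \<phi> (S (S x * a))" for x
    by (simp only: phi_S[of "S x * a"] antipode_mult[of "Sinv (a \<lhd> \<delta>)"] multiplier_assoc(2) S_Sinv)
  then show ?thesis by blast
qed

lemma left_modular_automorphism:
  assumes "modular_automorphism \<Delta> \<phi> (dual_left_integral (\<phi> \<circ> S) S \<epsilon>) \<sigma>" and b: "b \<in> dual \<phi>"
  shows "\<sigma> b x = b (S (S x) \<lhd> \<delta>')"
proof -
  obtain d where d: "b = dual_element \<phi> d" using b by (auto simp: dual_def)
  have "\<sigma> b \<in> dual \<phi>" using assms by (auto simp: modular_automorphism_def dual_automorphism_def bij_betw_def)
  then obtain e' where e': "\<sigma> b = dual_element \<phi> e'" by (auto simp: dual_def)
  obtain e where e: "\<And>x. \<phi> (x * e') = \<phi> (S (S x * e))" using dual_as_psi by blast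
  have *: "\<phi> (a * d) = \<phi> (S (S e * a))" for a
  proof -
    obtain c where c: "\<And>x. \<phi> (x * c) = \<phi> (S (S x * a))" using psi_in_dual by blast
    have "dual_element \<phi> c \<in> dual \<phi>" by (simp add: dual_def)
    \<comment> \<open>The modular property for \<open>b\<close> and \<open>\<phi>(\<sqdot> c)\<close>, with both integrals evaluated by the product formula.\<close>
    then have "\<phi> (a * d) = \<phi> (e * c)"
      using assms unfolding modular_automorphism_def
      by (metis d e' dual_left_integral_mult[OF c] dual_left_integral_mult[OF e])
    then show ?thesis by (simp add: c)
  qed
  \<comment> \<open>The case \<open>a = S\<^sup>2(x) \<delta>\<^sup>-\<^sup>1\<close>, where \<open>\<psi>\<close> turns back into \<open>\<phi>\<close>.\<close>
  have "b (S (S x) \<lhd> \<delta>') = \<phi> (S (S e * (S (S x) \<lhd> \<delta>')))"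
    by (simp add: d dual_element_def *)
  also have "\<dots> = \<phi> (S e * S (S x))"
    by (simp only: phi_S[of "S e * (S (S x) \<lhd> \<delta>')"] multiplier_assoc(2) \<delta>_cancel)
  also have "\<dots> = \<sigma> b x" by (simp add: e' dual_element_def e antipode_mult)
  finally show ?thesis by simp
qed

lemma right_modular_automorphism:
  assumes "modular_automorphism \<Delta> \<phi> (dual_right_integral \<phi> \<epsilon>) \<sigma>" and b: "b \<in> dual \<phi>"
  shows "\<sigma> b x = b (\<delta>' \<rhd> Sinv (Sinv x))"
proof -
  obtain d where d: "b = dual_element \<phi> d" using b by (auto simp: dual_def)
  have "\<sigma> b \<in> dual \<phi>" using assms by (auto simp: modular_automorphism_def dual_automorphism_def bij_betw_def)
  then obtain e where e: "\<sigma> b = dual_element \<phi> e" by (auto simp: dual_def)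
  have *: "\<phi> (Sinv c * d) = \<phi> (Sinv e * c)" for c
  proof -
    have "dual_element \<phi> c \<in> dual \<phi>" by (simp add: dual_def)
    then show ?thesis using assms unfolding modular_automorphism_def by (metis d e dual_right_integral_mult)
  qed
  \<comment> \<open>The case \<open>c = S\<^sup>-\<^sup>1(x) \<delta>\<close>, where \<open>\<phi>\<close> turns into \<open>\<psi>\<close>.\<close>
  have "b (\<delta>' \<rhd> Sinv (Sinv x)) = \<phi> (Sinv (Sinv x \<lhd> \<delta>) * d)"
    by (simp add: d dual_element_def Sinv_modular)
  also have "\<dots> = \<phi> ((Sinv e * Sinv x) \<lhd> \<delta>)" by (simp only: * multiplier_assoc)
  also have "\<dots> = \<sigma> b x" by (simp add: phi_S[symmetric] Sinv_mult[symmetric] e dual_element_def)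
  finally show ?thesis by simp
qed

end

theorem proposition2p5:
  fixes \<Delta> :: "'a::nondegenerate_algebra \<Rightarrow> ('a, 'a) tensor multiplier"
    and \<epsilon> :: "'a \<Rightarrow> complex"
    and S :: "'a \<Rightarrow> 'a"
    and \<phi> \<psi> :: "'a \<Rightarrow> complex"
    and \<delta> :: "'a multiplier"
    and \<sigma> \<sigma>' :: "('a \<Rightarrow> complex) \<Rightarrow> ('a \<Rightarrow> complex)"
  assumes "algebraic_quantum_group \<Delta>"
    and "counit \<Delta> \<epsilon>"
    and "antipode \<Delta> \<epsilon> S"
    and "left_integral \<Delta> \<phi>"
    and "right_integral \<Delta> \<psi>"
    and "\<psi> = \<phi> \<circ> S"
    and "modular_element \<phi> S \<delta>"
    and "modular_automorphism \<Delta> \<phi> (dual_left_integral \<psi> S \<epsilon>) \<sigma>"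
    and "modular_automorphism \<Delta> \<phi> (dual_right_integral \<phi> \<epsilon>) \<sigma>'"
  shows "\<forall>a. \<forall>b\<in>dual \<phi>.
      \<sigma> b a = b ((S ^^ 2) a \<lhd> multiplier_inverse \<delta>) \<and>
      \<sigma>' b a = b (multiplier_inverse \<delta> \<rhd> (inv S ^^ 2) a)"
proof -
  obtain \<delta>' where \<delta>': "\<delta> * \<delta>' = 1" "\<delta>' * \<delta> = 1" and \<phi>S: "\<And>a. \<phi> (S a) = \<phi> (a \<lhd> \<delta>)"
    using assms(7) by (auto simp: modular_element_def)
  have inverse: "multiplier_inverse \<delta> = \<delta>'"
    unfolding multiplier_inverse_def
  proof (rule the_equality)
    fix n assume "\<delta> * n = 1 \<and> n * \<delta> = 1"
    then have "n * (\<delta> * \<delta>') = \<delta>'" by (simp add: mult.assoc[symmetric])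
    then show "n = \<delta>'" by (simp add: \<delta>')
  qed (simp add: \<delta>')
  interpret regular_multiplier_Hopf_algebra \<Delta>
    using assms(1) by (simp add: algebraic_quantum_group_def)
  interpret modular_left_invariant \<Delta> \<epsilon> S \<phi> \<delta> \<delta>'
    by unfold_locales (fact assms(2,3,4) \<delta>' \<phi>S)+
  show ?thesis
    using left_modular_automorphism[OF assms(8)[unfolded assms(6)]] right_modular_automorphism[OF assms(9)]
    by (simp add: inverse numeral_2_eq_2)
qed

end
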